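(* Let $b\geq 2$ be an integer and let $A=(a_n)_{n=1}^{\infty}$ be a strictly increasing sequence of positive integers. Suppose that $\eta:=\lim_{n\to\infty}\frac{a_{n+1}}{a_n}$ exists and $1<\eta<+\infty$. If $\hat v\in[0,\eta]$ satisfies $\hat v=\eta-\frac{2}{\eta^{l}}$ for some positive integer $l$, then $$\dim_{\rm H}(\hat{\mathcal V}^{\ast}_{b,A}(\hat v))=\dim_{\rm H}(\hat{\mathcal V}_{b,A}(\hat v))=\left(\frac{\eta-\hat v}{\eta+\hat v}\right)^2.$$
   Context: $\|x\|$ denotes the distance from $x\in\mathbb R$ to the nearest integer; $\dim_{\rm H}$ is Hausdorff dimension. For real $\xi$, $$\hat v_{b,A}(\xi):=\sup\Big\{\hat v\ge 0:\ \text{for all sufficiently large integers }N,\ \min_{1\le n\le N}\|b^{a_n}\xi\|<(b^{a_N})^{-\hat v}\Big\}\in[0,+\infty].$$ (The exponent is introduced for irrational $\xi$; for rational $\xi$ the same formula is used.) For $\hat v\in[0,\eta]$, $$\hat{\mathcal V}_{b,A}(\hat v):=\{\xi\in\mathbb R:\hat v_{b,A}(\xi)\ge\hat v\},\qquad \hat{\mathcal V}^{\ast}_{b,A}(\hat v):=\{\xi\in\mathbb R:\hat v_{b,A}(\xi)=\hat v\}.$$ *)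

theory Defs
  imports "HOL-Analysis.Analysis"
begin

text \<open>Hausdorff measure and dimension. The case distinctions in the weight implement the
  usual conventions that the empty set has weight 0 and that a nonempty set has weight 1 for
  s = 0, whereas in the library 0 powr 0 = 0. Boundedness of the covering sets is
  required explicitly because \<^const>\<open>diameter\<close> has no meaningful value on unbounded sets.\<close>

definition hausdorff_weight :: "real \<Rightarrow> 'a::metric_space set \<Rightarrow> ennreal" where
  "hausdorff_weight s U =
     (if U = {} then 0 else if s = 0 then 1 else ennreal (diameter U powr s))"

definition hausdorff_premeasure :: "real \<Rightarrow> real \<Rightarrow> 'a::metric_space set \<Rightarrow> ennreal" where
  "hausdorff_premeasure s \<delta> E =
     (INF U \<in> {U :: nat \<Rightarrow> 'a set.
                 E \<subseteq> (\<Union>i. U i) \<and> (\<forall>i. bounded (U i) \<and> diameter (U i) \<le> \<delta>)}.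
        \<Sum>i. hausdorff_weight s (U i))"

definition hausdorff_measure :: "real \<Rightarrow> 'a::metric_space set \<Rightarrow> ennreal" where
  "hausdorff_measure s E = (SUP \<delta> \<in> {0<..}. hausdorff_premeasure s \<delta> E)"

definition hausdorff_dim :: "'a::metric_space set \<Rightarrow> ereal" where
  "hausdorff_dim E = Inf {ereal s | s. 0 \<le> s \<and> hausdorff_measure s E = 0}"

definition dist_nearest_int :: "real \<Rightarrow> real" where
  "dist_nearest_int x = \<bar>x - of_int (round x)\<bar>"

text \<open>Sequences are indexed from 1; the value \<open>a 0\<close> is never used.\<close>

definition uniform_exponent :: "nat \<Rightarrow> (nat \<Rightarrow> nat) \<Rightarrow> real \<Rightarrow> ereal" where
  "uniform_exponent b a \<xi> =
     Sup {ereal v | v. 0 \<le> v \<and>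
       (\<forall>\<^sub>F N in sequentially.
          Min ((\<lambda>n. dist_nearest_int (real b ^ a n * \<xi>)) ` {1..N})
            < (real b ^ a N) powr (- v))}"

definition uniform_set_ge :: "nat \<Rightarrow> (nat \<Rightarrow> nat) \<Rightarrow> real \<Rightarrow> real set" where
  "uniform_set_ge b a v = {\<xi>. uniform_exponent b a \<xi> \<ge> ereal v}"

definition uniform_set_eq :: "nat \<Rightarrow> (nat \<Rightarrow> nat) \<Rightarrow> real \<Rightarrow> real set" where
  "uniform_set_eq b a v = {\<xi>. uniform_exponent b a \<xi> = ereal v}"

end

(* Let s0(v) = ((eta - v) / (eta + v))^2.

   Upper bound, for every 0 < v < eta: the indices n_0 < n_1 < ... of the successive minima of
   ||b^(a_n) xi|| satisfy ||b^(a_(n_k)) xi|| < b^(-w a_(n_(k+1))) with w close to v / eta. Given the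
   nearest integer to b^(a_(n_k)) xi there are about b^((1-w) a_(n_(k+1)) - a_(n_k)) choices for
   the next one, so xi lies in one of about b^F intervals of length b^(-A_k - w A_(k+1)), where
   A_k = a_(n_k) and F = (1-w) A_k - w (A_0 + ... + A_(k-1)). For s > s0(v) infinitely many k have
   F < s (A_k + w A_(k+1)), and the number of chains of indices up to m is at most 2^m,
   which is negligible since a_m grows exponentially.

   Lower bound, for v = eta - 2 / eta^l: this is the case in which the optimal ratio
   A_(k+1) / A_k = eta^(l+1) is attained, by n_k = (k + 1) (l + 1). Keep all digits free except for
   blocks of zeros of length v a_(n_(k+1) - 1) behind each position A_k. Inserting the digits of
   t in [0,1) at the free positions gives a map h into the set of xi with exponent at least v
   whose inverse is s-Hoelder for all s < s0(v), so preimages of H^s-null sets are Lebesgue null.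
   Since s0 is strictly decreasing, the upper bound applied to v' > v shows that almost every
   h(t) has exponent exactly v. *)

theory Submission
  imports Defs
begin

section \<open>Null sets of Hausdorff measures\<close>

text \<open>Everything below uses \<open>hausdorff_measure\<close> only through its null sets; this
  rule and its converse translate them into countable covers of arbitrarily small weight.\<close>

lemma hausdorff_measure_zeroI:
  assumes "\<And>\<delta> \<epsilon>. 0 < \<delta> \<Longrightarrow> 0 < \<epsilon> \<Longrightarrow> \<exists>U. E \<subseteq> (\<Union>i::nat. U i) \<and>
     (\<forall>i. bounded (U i) \<and> diameter (U i) \<le> \<delta>) \<and> (\<Sum>i. hausdorff_weight s (U i)) \<le> ennreal \<epsilon>"
  shows "hausdorff_measure s E = 0"
proof -
  have "hausdorff_premeasure s \<delta> E \<le> 0" if d: "\<delta> > 0" for \<delta>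
  proof (rule ennreal_le_epsilon)
    fix e :: real assume e: "0 < e"
    obtain U where U: "E \<subseteq> (\<Union>i::nat. U i)" "\<forall>i. bounded (U i) \<and> diameter (U i) \<le> \<delta>"
       "(\<Sum>i. hausdorff_weight s (U i)) \<le> ennreal e"
      using assms[OF d e] by blast
    have "hausdorff_premeasure s \<delta> E \<le> (\<Sum>i. hausdorff_weight s (U i))"
      unfolding hausdorff_premeasure_def by (rule INF_lower) (use U in auto)
    with U show "hausdorff_premeasure s \<delta> E \<le> 0 + ennreal e" by simp
  qed
  then show ?thesis unfolding hausdorff_measure_def
    by (intro antisym SUP_least) auto
qed

lemma hausdorff_measure_zeroD:
  assumes "hausdorff_measure s E = 0" "0 < \<delta>" "0 < (\<epsilon>::real)"
  obtains U :: "nat \<Rightarrow> 'a::metric_space set" where "E \<subseteq> (\<Union>i. U i)"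
     "\<And>i. bounded (U i)" "\<And>i. diameter (U i) \<le> \<delta>" "(\<Sum>i. hausdorff_weight s (U i)) < ennreal \<epsilon>"
proof -
  have "hausdorff_premeasure s \<delta> E \<le> hausdorff_measure s E"
    unfolding hausdorff_measure_def by (rule SUP_upper) (use assms in auto)
  with assms have "hausdorff_premeasure s \<delta> E < ennreal \<epsilon>" by simp
  then show ?thesis unfolding hausdorff_premeasure_def INF_less_iff using that by blast
qed

lemma hausdorff_measure_zero_subset:
  assumes "hausdorff_measure s F = 0" "E \<subseteq> F"
  shows "hausdorff_measure s E = 0"
proof (rule hausdorff_measure_zeroI)
  fix \<delta> \<epsilon> :: real assume "0 < \<delta>" "0 < \<epsilon>"
  from hausdorff_measure_zeroD[OF assms(1) this] obtain U where
    "F \<subseteq> (\<Union>i. U i)" "\<And>i. bounded (U i)" "\<And>i. diameter (U i) \<le> \<delta>"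
    "(\<Sum>i. hausdorff_weight s (U i)) < ennreal \<epsilon>" by blast
  then show "\<exists>U. E \<subseteq> (\<Union>i::nat. U i) \<and>
     (\<forall>i. bounded (U i) \<and> diameter (U i) \<le> \<delta>) \<and> (\<Sum>i. hausdorff_weight s (U i)) \<le> ennreal \<epsilon>"
    using assms(2) by (intro exI[of _ U]) (auto intro: less_imp_le)
qed

lemma hausdorff_measure_zero_empty:
  "hausdorff_measure s ({} :: 'a::metric_space set) = 0"
  by (rule hausdorff_measure_zeroI, rule exI[of _ "\<lambda>_. {}"])
     (auto simp: hausdorff_weight_def diameter_def)

text \<open>For exponent 0 every nonempty covering set costs 1, so a cover of weight below 1
  consists of empty sets. This settles the exponent 0 in \<open>hausdorff_dim_ge\<close>.\<close>

lemma hausdorff_measure_0_eq_0_iff: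
  "hausdorff_measure 0 E = 0 \<longleftrightarrow> E = {}"
proof
  assume "hausdorff_measure 0 E = 0"
  from hausdorff_measure_zeroD[OF this, of 1 1] obtain U where
    U: "E \<subseteq> (\<Union>i. U i)" "(\<Sum>i. hausdorff_weight 0 (U i)) < ennreal 1" by (metis zero_less_one)
  have "U i = {}" for i
  proof (rule ccontr)
    assume "U i \<noteq> {}"
    then have "1 = sum (\<lambda>i. hausdorff_weight 0 (U i)) {i}" by (simp add: hausdorff_weight_def)
    also have "\<dots> \<le> (\<Sum>i. hausdorff_weight 0 (U i))" by (rule sum_le_suminf) auto
    finally show False using U(2) by auto
  qed
  with U show "E = {}" by auto
qed (simp add: hausdorff_measure_zero_empty)

text \<open>The n-th set receives a cover of weight below \<open>\<epsilon> / 2 ^ (n + 1)\<close>,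
  and \<open>prod_decode\<close> merges these covers into one sequence.\<close>

lemma hausdorff_measure_zero_UN:
  fixes E :: "nat \<Rightarrow> 'a::metric_space set"
  assumes "\<And>n. hausdorff_measure s (E n) = 0"
  shows "hausdorff_measure s (\<Union>n. E n) = 0"
proof (rule hausdorff_measure_zeroI)
  fix \<delta> \<epsilon> :: real assume de: "0 < \<delta>" "0 < \<epsilon>"
  have "\<forall>n. \<exists>U. E n \<subseteq> (\<Union>i. U i) \<and> (\<forall>i::nat. bounded (U i) \<and> diameter (U i) \<le> \<delta>) \<and>
     (\<Sum>i. hausdorff_weight s (U i)) < ennreal (\<epsilon> * (1/2)^Suc n)"
  proof
    fix n
    have "0 < \<epsilon> * (1/2)^Suc n" using de by simp
    from hausdorff_measure_zeroD[OF assms[of n] de(1) this]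
    show "\<exists>U. E n \<subseteq> (\<Union>i. U i) \<and> (\<forall>i::nat. bounded (U i) \<and> diameter (U i) \<le> \<delta>) \<and>
     (\<Sum>i. hausdorff_weight s (U i)) < ennreal (\<epsilon> * (1/2)^Suc n)" by metis
  qed
  then obtain U where U: "\<And>n. E n \<subseteq> (\<Union>i. U n i)" 
    "\<And>n i::nat. bounded (U n i) \<and> diameter (U n i) \<le> \<delta>"
    "\<And>n. (\<Sum>i. hausdorff_weight s (U n i)) < ennreal (\<epsilon> * (1/2)^Suc n)" by metis
  define V where "V j = (case prod_decode j of (n, i) \<Rightarrow> U n i)" for j
  have "(\<Sum>j. hausdorff_weight s (V j)) = (\<Sum>n. \<Sum>i. hausdorff_weight s (U n i))"
    using suminf_ennreal_2dimen[of "\<lambda>n. \<Sum>i. hausdorff_weight s (U n i)" "\<lambda>(n,i). hausdorff_weight s (U n i)"]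
    by (simp add: V_def case_prod_unfold)
  also have "\<dots> \<le> (\<Sum>n. ennreal (\<epsilon> * (1/2)^Suc n))"
    by (intro suminf_le) (use U(3) less_imp_le in auto)
  also have "\<dots> = ennreal (\<Sum>n. \<epsilon> * (1/2)^Suc n)"
    using de power_half_series by (intro suminf_ennreal2 summable_mult) (auto simp: sums_iff)
  also have "(\<Sum>n. \<epsilon> * (1/2)^Suc n) = \<epsilon>"
    using power_half_series by (subst suminf_mult) (auto simp: sums_iff)
  finally have "(\<Sum>j. hausdorff_weight s (V j)) \<le> ennreal \<epsilon>" .
  moreover have "(\<Union>n. E n) \<subseteq> (\<Union>j. V j)"
  proof
    fix x assume "x \<in> (\<Union>n. E n)"
    then obtain n i where "x \<in> U n i" using U(1) by blast
    then have "x \<in> V (prod_encode (n, i))" by (simp add: V_def)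
    then show "x \<in> (\<Union>j. V j)" by blast
  qed
  ultimately show "\<exists>U. (\<Union>n. E n) \<subseteq> (\<Union>i::nat. U i) \<and>
     (\<forall>i. bounded (U i) \<and> diameter (U i) \<le> \<delta>) \<and> (\<Sum>i. hausdorff_weight s (U i)) \<le> ennreal \<epsilon>"
    using U(2) by (intro exI[of _ V]) (auto simp: V_def split: prod.splits)
qed

lemma hausdorff_measure_zero_Un:
  assumes "hausdorff_measure s E = 0" "hausdorff_measure s F = 0"
  shows "hausdorff_measure s (E \<union> F) = 0"
proof -
  have "hausdorff_measure s (\<Union>n::nat. if n = 0 then E else F) = 0"
    by (rule hausdorff_measure_zero_UN) (use assms in auto)
  moreover have "(\<Union>n::nat. if n = 0 then E else F) = E \<union> F" by (auto split: if_splits)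
  ultimately show ?thesis by simp
qed

lemma hausdorff_weight_pos:
  "s > 0 \<Longrightarrow> hausdorff_weight s U = (if U = {} then 0 else ennreal (diameter U powr s))"
  by (simp add: hausdorff_weight_def)

lemma hausdorff_measure_zero_countable:
  assumes "countable E" "s > 0"
  shows "hausdorff_measure s E = 0"
proof (rule hausdorff_measure_zeroI)
  fix \<delta> \<epsilon> :: real assume de: "0 < \<delta>" "0 < \<epsilon>"
  have "E \<subseteq> (\<Union>n. {from_nat_into E n})"
    using from_nat_into_surj[OF assms(1)] by fastforce
  then show "\<exists>U. E \<subseteq> (\<Union>i::nat. U i) \<and>
     (\<forall>i. bounded (U i) \<and> diameter (U i) \<le> \<delta>) \<and> (\<Sum>i. hausdorff_weight s (U i)) \<le> ennreal \<epsilon>"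
    using assms de by (intro exI[of _ "\<lambda>n. {from_nat_into E n}"]) (simp add: hausdorff_weight_pos)
qed

text \<open>The easy half of the Borel-Cantelli lemma: the levels from \<open>M\<close> on cover
  \<open>E\<close>, and their total cost is at most a tail of the convergent series of
  \<open>c\<close>.\<close>

lemma hausdorff_measure_zero_limsup:
  fixes U :: "nat \<Rightarrow> 'i \<Rightarrow> 'a::metric_space set"
  assumes s: "s > 0" and fin: "\<And>n. finite (I n)"
    and bdd: "\<And>n i. i \<in> I n \<Longrightarrow> bounded (U n i)"
    and cost: "\<And>n. (\<Sum>i\<in>I n. diameter (U n i) powr s) \<le> c n"
    and c: "summable c"
    and E: "\<And>x M. x \<in> E \<Longrightarrow> \<exists>n\<ge>M. \<exists>i\<in>I n. x \<in> U n i"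
  shows "hausdorff_measure s E = 0"
proof (rule hausdorff_measure_zeroI)
  fix \<delta> \<epsilon> :: real assume de: "0 < \<delta>" "0 < \<epsilon>"
  \<comment> \<open>Each single term of the cost is at most the tail sum, so keeping the tail below
    \<open>\<delta> powr s\<close> also bounds every diameter by \<open>\<delta>\<close>.\<close>
  define e where "e = min \<epsilon> (\<delta> powr s)"
  have e: "e > 0" using de by (simp add: e_def)
  have c0: "0 \<le> c n" for n using cost[of n] sum_nonneg[of "I n" "\<lambda>i. diameter (U n i) powr s"] by simp
  obtain M where M: "(\<Sum>n. c (n + M)) < e"
  proof -
    obtain M where "\<And>m. m \<ge> M \<Longrightarrow> norm (\<Sum>i. c (i + m)) < e" using suminf_exist_split[OF e c] by blast
    then show ?thesis using that[of M] by fastforce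
  qed
  have "\<forall>n. \<exists>g. bij_betw g {..<card (I n)} (I n)" 
    using ex_bij_betw_nat_finite fin by (metis atLeast0LessThan)
  then obtain g where g: "\<And>n. bij_betw (g n) {..<card (I n)} (I n)" by metis
  \<comment> \<open>Padding with the empty set, which has weight 0, turns the finite families into
    sequences.\<close>
  define V where "V n i = (if i < card (I n) then U n (g n i) else {})" for n i
  have gI: "g n i \<in> I n" if "i < card (I n)" for n i using g[of n] that by (auto simp: bij_betw_def)
  define W where "W j = (case prod_decode j of (n, i) \<Rightarrow> V (n + M) i)" for j
  have row: "(\<Sum>i. hausdorff_weight s (V n i)) \<le> ennreal (c n)" for n
  proof -
    have "(\<Sum>i. hausdorff_weight s (V n i)) = (\<Sum>i<card (I n). hausdorff_weight s (V n i))"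
      by (rule suminf_finite) (auto simp: V_def hausdorff_weight_def)
    also have "\<dots> \<le> (\<Sum>i<card (I n). ennreal (diameter (U n (g n i)) powr s))"
      by (rule sum_mono) (auto simp: V_def hausdorff_weight_pos[OF s])
    also have "\<dots> = (\<Sum>i\<in>I n. ennreal (diameter (U n i) powr s))"
      by (rule sum.reindex_bij_betw[OF g])
    also have "\<dots> = ennreal (\<Sum>i\<in>I n. diameter (U n i) powr s)" by (simp add: sum_ennreal)
    also have "\<dots> \<le> ennreal (c n)" using cost by (rule ennreal_leI)
    finally show ?thesis .
  qed
  have "(\<Sum>j. hausdorff_weight s (W j)) = (\<Sum>n. \<Sum>i. hausdorff_weight s (V (n + M) i))"
    using suminf_ennreal_2dimen[of "\<lambda>n. \<Sum>i. hausdorff_weight s (V (n+M) i)" "\<lambda>(n,i). hausdorff_weight s (V (n+M) i)"]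
    by (simp add: W_def case_prod_unfold)
  also have "\<dots> \<le> (\<Sum>n. ennreal (c (n + M)))" by (intro suminf_le row) auto
  also have "\<dots> = ennreal (\<Sum>n. c (n + M))"
    using c c0 by (intro suminf_ennreal2) (auto simp: summable_iff_shift)
  also have "\<dots> \<le> ennreal \<epsilon>" using M by (intro ennreal_leI) (simp add: e_def)
  finally have 1: "(\<Sum>j. hausdorff_weight s (W j)) \<le> ennreal \<epsilon>" .
  have 2: "E \<subseteq> (\<Union>j. W j)"
  proof
    fix x assume "x \<in> E"
    then obtain n i where n: "n \<ge> M" "i \<in> I n" "x \<in> U n i" using E by blast
    obtain k where k: "k < card (I n)" "g n k = i"
      using n(2) g[of n] by (metis bij_betw_iff_bijections lessThan_iff)
    have "x \<in> W (prod_encode (n - M, k))" using n k by (simp add: W_def V_def)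
    then show "x \<in> (\<Union>j. W j)" by blast
  qed
  have 3: "bounded (V n i)" for n i using bdd gI by (simp add: V_def)
  have 4: "diameter (V n i) \<le> \<delta>" if "n \<ge> M" for n i
  proof (cases "i < card (I n)")
    case True
    have "diameter (U n (g n i)) powr s \<le> (\<Sum>i\<in>I n. diameter (U n i) powr s)"
      by (rule member_le_sum) (use gI[OF True] fin in auto)
    also have "\<dots> \<le> c n" by (rule cost)
    also have "\<dots> = (\<Sum>k\<in>{n - M}. c (k + M))" using that by simp
    also have "\<dots> \<le> (\<Sum>n. c (n + M))"
      using c c0 by (intro sum_le_suminf) (auto simp: summable_iff_shift)
    also have "\<dots> \<le> \<delta> powr s" using M by (simp add: e_def)
    finally have "diameter (U n (g n i)) \<le> \<delta>" 
      by (metis de(1) linorder_not_le powr_less_mono2 less_imp_le s)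
    with True show ?thesis by (simp add: V_def)
  qed (use de in \<open>simp add: V_def diameter_def\<close>)
  show "\<exists>U. E \<subseteq> (\<Union>i::nat. U i) \<and>
     (\<forall>i. bounded (U i) \<and> diameter (U i) \<le> \<delta>) \<and> (\<Sum>i. hausdorff_weight s (U i)) \<le> ennreal \<epsilon>"
    using 1 2 3 4 by (intro exI[of _ W]) (auto simp: W_def split: prod.splits)
qed

text \<open>Dyadic subdivision of a unit interval costs \<open>2 powr (n * (1 - s))\<close> at level
  \<open>n\<close>, which is summable. This serves the case \<open>v = 0\<close>, where the claimed
  dimension is 1.\<close>

lemma hausdorff_measure_real_zero:
  assumes "s > 1"
  shows "hausdorff_measure s (E :: real set) = 0"
proof -
  have "hausdorff_measure s {real_of_int z..<real_of_int z + 1} = 0" for z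
  proof (rule hausdorff_measure_zero_limsup[where I = "\<lambda>n. {..<2^n}" and c = "\<lambda>n. ((1/2) powr (s - 1)) ^ n"
        and U = "\<lambda>n i. {real_of_int z + real i / 2^n .. real_of_int z + (real i + 1) / 2^n}"])
    show "summable (\<lambda>n. ((1/2::real) powr (s - 1)) ^ n)"
      using assms powr_less_mono2[of "s - 1" "1/2" "1::real"] by (intro summable_geometric) auto
    fix n
    have "diameter {real_of_int z + real i / 2^n .. real_of_int z + (real i + 1) / 2^n} = (1/2)^n" for i
      by (subst diameter_closed_interval) (auto simp: field_simps)
    then have "(\<Sum>i<2^n. diameter {real_of_int z + real i / 2^n .. real_of_int z + (real i + 1) / 2^n} powr s)
       = 2 ^ n * ((1/2)^n) powr s" by simp
    also have "\<dots> = ((1/2) powr (s - 1)) ^ n"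
    proof -
      have "((1/2::real)^n) powr s = ((1/2) powr s)^n"
        by (subst (1 2) powr_realpow[symmetric]) (auto simp: powr_powr mult.commute)
      moreover have "(1/2::real) powr (s - 1) = 2 * (1/2) powr s" by (simp add: powr_diff)
      ultimately show ?thesis by (simp only: power_mult_distrib)
    qed
    finally show "(\<Sum>i<2^n. diameter {real_of_int z + real i / 2^n .. real_of_int z + (real i + 1) / 2^n} powr s)
       \<le> ((1/2) powr (s - 1)) ^ n" by simp
  next
    fix x M assume x: "x \<in> {real_of_int z..<real_of_int z + 1}"
    define i where "i = nat \<lfloor>(x - z) * 2^M\<rfloor>"
    have 0: "0 \<le> (x - z) * 2^M" using x by simp
    then have i: "real i \<le> (x - z) * 2^M" "(x - z) * 2^M < real i + 1" unfolding i_def by linarith+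
    have "(x - z) * 2^M < 2^M" using x by simp
    with i have "real i < 2^M" by linarith
    then have "i < 2^M" by (metis of_nat_less_numeral_power_cancel_iff)
    moreover have "x \<in> {real_of_int z + real i / 2^M .. real_of_int z + (real i + 1) / 2^M}"
      using i by (simp add: field_simps)
    ultimately show "\<exists>n\<ge>M. \<exists>i\<in>{..<2 ^ n}. x \<in> {real_of_int z + real i / 2^n .. real_of_int z + (real i + 1) / 2^n}"
      by blast
  qed (use assms in auto)
  then have "hausdorff_measure s (\<Union>n. {real_of_int (from_nat n)..<real_of_int (from_nat n) + 1}) = 0"
    by (intro hausdorff_measure_zero_UN)
  moreover have "E \<subseteq> (\<Union>n. {real_of_int (from_nat n)..<real_of_int (from_nat n) + 1})"
  proof
    fix x :: real
    have "x \<in> {real_of_int (from_nat (to_nat \<lfloor>x\<rfloor>))..<real_of_int (from_nat (to_nat \<lfloor>x\<rfloor>)) + 1}"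
      by simp
    then show "x \<in> (\<Union>n. {real_of_int (from_nat n)..<real_of_int (from_nat n) + 1})" by blast
  qed
  ultimately show ?thesis by (rule hausdorff_measure_zero_subset)
qed

text \<open>The preimage of a set of diameter \<open>D\<close> fits into an interval of length
  \<open>2 * C * D powr s\<close>, so covers of small weight pull back to covers of small length. In
  the lower bound this takes the place of a mass distribution principle.\<close>

lemma holder_inverse_preimage_null:
  fixes h :: "real \<Rightarrow> real"
  assumes s: "s > 0" and C: "C > 0"
    and h: "\<And>t t'. t \<in> T \<Longrightarrow> t' \<in> T \<Longrightarrow> \<bar>t - t'\<bar> \<le> C * \<bar>h t - h t'\<bar> powr s"
    and E: "hausdorff_measure s E = 0"
  shows "negligible {t \<in> T. h t \<in> E}"
proof -
  have "\<exists>S\<in>lmeasurable. {t \<in> T. h t \<in> E} \<subseteq> S \<and> measure lebesgue S < e" if e: "e > 0" for e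
  proof -
    \<comment> \<open>After multiplication by \<open>2 * C\<close> this becomes
      \<open>e / 2\<close>, which leaves room for the strict inequality.\<close>
    have "0 < e / (4 * C)" using e C by simp
    then obtain U where U: "E \<subseteq> (\<Union>i. U i)" "\<And>i. bounded (U i)"
      "\<And>i. diameter (U i) \<le> 1" "(\<Sum>i. hausdorff_weight s (U i)) < ennreal (e / (4 * C))"
      by (rule hausdorff_measure_zeroD[OF E zero_less_one]) (rule that)
    define D where "D i = C * diameter (U i) powr s" for i
    define Q where "Q i = {t \<in> T. h t \<in> U i}" for i
    \<comment> \<open>Any point of \<open>Q i\<close> may serve as centre, since all others are
      within \<open>D i\<close> of it.\<close>
    define J where "J i = (if Q i = {} then {} else {(SOME t. t \<in> Q i) - D i .. (SOME t. t \<in> Q i) + D i})" for i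
    have QJ: "Q i \<subseteq> J i" for i
    proof
      fix t assume t: "t \<in> Q i"
      define u where "u = (SOME t. t \<in> Q i)"
      have u: "u \<in> Q i" unfolding u_def using t by (rule someI)
      have "\<bar>h t - h u\<bar> \<le> diameter (U i)"
        using diameter_bounded_bound[OF U(2)[of i], of "h t" "h u"] t u by (auto simp: Q_def dist_real_def)
      then have "\<bar>h t - h u\<bar> powr s \<le> diameter (U i) powr s" using s by (intro powr_mono2) auto
      then have "\<bar>t - u\<bar> \<le> D i" using h[of t u] t u C unfolding Q_def D_def
        by (smt (verit, best) mem_Collect_eq mult_left_mono)
      then show "t \<in> J i" using t unfolding J_def u_def[symmetric] by auto
    qed
    have emJ: "emeasure lborel (J i) \<le> ennreal (2 * C) * hausdorff_weight s (U i)" for i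
    proof (cases "Q i = {}")
      case False
      then have "U i \<noteq> {}" by (auto simp: Q_def)
      then show ?thesis using False s C
        by (simp add: J_def D_def hausdorff_weight_pos flip: ennreal_mult'' ennreal_mult)
    qed (simp add: J_def)
    have meas: "J i \<in> sets lborel" for i by (simp add: J_def)
    have "emeasure lborel (\<Union>i. J i) \<le> (\<Sum>i. emeasure lborel (J i))"
      by (rule emeasure_subadditive_countably) (use meas in auto)
    also have "\<dots> \<le> (\<Sum>i. ennreal (2 * C) * hausdorff_weight s (U i))"
      by (rule suminf_le) (use emJ in auto)
    also have "\<dots> = ennreal (2 * C) * (\<Sum>i. hausdorff_weight s (U i))" by simp
    also have "\<dots> \<le> ennreal (2 * C) * ennreal (e / (4 * C))"
      using U(4) by (intro mult_left_mono) auto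
    also have "\<dots> = ennreal (e / 2)" using C e by (subst ennreal_mult'[symmetric]) (auto simp: field_simps)
    finally have le: "emeasure lborel (\<Union>i. J i) \<le> ennreal (e / 2)" .
    have ms: "(\<Union>i. J i) \<in> sets lborel" using meas by blast
    have eq: "emeasure lebesgue (\<Union>i. J i) = emeasure lborel (\<Union>i. J i)"
      using ms by (simp add: emeasure_completion)
    have lm: "(\<Union>i. J i) \<in> lmeasurable"
      using le ms eq by (intro fmeasurableI) (auto intro: le_less_trans)
    have "measure lebesgue (\<Union>i. J i) \<le> e / 2"
      using le eq e unfolding measure_def by (intro enn2real_leI) auto
    moreover have "{t \<in> T. h t \<in> E} \<subseteq> (\<Union>i. J i)" using U(1) QJ unfolding Q_def by blast
    ultimately show ?thesis using lm e by (intro bexI[of _ "\<Union>i. J i"]) auto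
  qed
  then show ?thesis by (subst negligible_outer) blast
qed

section \<open>From null sets to bounds on the Hausdorff dimension\<close>

lemma hausdorff_dim_le:
  assumes "0 \<le> d" "\<And>s. d < s \<Longrightarrow> hausdorff_measure s E = 0"
  shows "hausdorff_dim E \<le> ereal d"
proof (rule ereal_le_epsilon2)
  fix e :: real assume "0 < e"
  then show "hausdorff_dim E \<le> ereal d + ereal e"
    unfolding hausdorff_dim_def using assms by (intro Inf_lower) auto
qed

text \<open>The hypothesis speaks of positive exponents only. Being non-null at \<open>d / 2\<close>
  makes \<open>E\<close> nonempty, hence non-null at exponent 0 as well.\<close>

lemma hausdorff_dim_ge:
  assumes "0 < d" "\<And>s. 0 < s \<Longrightarrow> s < d \<Longrightarrow> hausdorff_measure s E \<noteq> 0"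
  shows "ereal d \<le> hausdorff_dim E"
  unfolding hausdorff_dim_def
proof (rule Inf_greatest, clarsimp)
  fix s assume s: "0 \<le> s" "hausdorff_measure s E = 0"
  have "E \<noteq> {}" using assms(2)[of "d / 2"] assms(1) hausdorff_measure_zero_empty by auto
  then have "s \<noteq> 0" using s hausdorff_measure_0_eq_0_iff by auto
  then show "d \<le> s" using s assms(2)[of s] by force
qed

lemma hausdorff_dim_mono: "E \<subseteq> F \<Longrightarrow> hausdorff_dim E \<le> hausdorff_dim F"
  unfolding hausdorff_dim_def by (intro Inf_superset_mono) (auto intro: hausdorff_measure_zero_subset)

section \<open>Chains of best approximations\<close>

text \<open>With \<open>\<sigma> k = (\<Sum>j<k. A j) / A k\<close>, failure of the inequality for all large \<open>k\<close> bounds \<open>A (k + 1) / A k\<close>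
  from above, hence \<open>\<sigma> (k + 1)\<close> from below, in terms of \<open>\<sigma> k\<close>. The resulting increment of \<open>\<sigma>\<close> is governed by a
  quadratic in \<open>\<sigma>\<close> whose discriminant is negative exactly for \<open>s\<close> strictly between the critical value and 1.\<close>

lemma chain_selection:
  fixes A :: "nat \<Rightarrow> real"
  assumes w: "0 < w" "w < 1" and s: "((1 - w) / (1 + w))\<^sup>2 < s" "s < 1"
    and A: "\<And>k. 0 < A k" "filterlim A at_top sequentially"
  shows "\<exists>k\<ge>M. (1 - w) * A k - w * (\<Sum>j<k. A j) + C \<le> s * (A k + w * A (Suc k))"
proof (rule ccontr)
  assume neg: "\<not> ?thesis"
  \<comment> \<open>Lowering \<open>s\<close> to \<open>r\<close> frees the margin
    \<open>(s - r) * A k\<close>, which eventually exceeds \<open>C\<close>.\<close>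
  obtain r where r: "((1 - w) / (1 + w))\<^sup>2 < r" "r < s" using dense[OF s(1)] by blast
  have r0: "0 < r" using r(1) by (smt (verit) zero_le_power2)
  have r1: "r < 1" using r s by simp
  define B where "B = r * (1 + w) - (1 - w)"
  \<comment> \<open>\<open>c\<close> is the minimum of the quadratic in \<open>quad\<close>,
    attained at \<open>- B / (2 * w)\<close>.\<close>
  define c where "c = (4 * r * w\<^sup>2 - B\<^sup>2) / (4 * w)"
  have "(1 - w)\<^sup>2 < (1 + w)\<^sup>2 * r"
    using r(1) w by (simp add: power_divide divide_less_eq mult.commute)
  \<comment> \<open>As a polynomial in \<open>r\<close>, the discriminant
    \<open>B ^ 2 - 4 * r * w ^ 2\<close> has the roots \<open>((1 - w) / (1 + w)) ^ 2\<close> and 1,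
    and \<open>r\<close> lies strictly between them.\<close>
  then have "(r - 1) * ((1 + w)\<^sup>2 * r - (1 - w)\<^sup>2) < 0" using r1 by (simp add: mult_neg_pos)
  also have "(r - 1) * ((1 + w)\<^sup>2 * r - (1 - w)\<^sup>2) = B\<^sup>2 - 4 * r * w\<^sup>2"
    unfolding B_def by algebra
  finally have c: "c > 0" using w by (simp add: c_def)
  have quad: "w * x\<^sup>2 + B * x + r * w \<ge> c" for x
  proof -
    have "w * x\<^sup>2 + B * x + r * w = w * (x + B / (2 * w))\<^sup>2 + c"
      using w by (simp add: c_def field_simps power2_eq_square)
    then show ?thesis using w by simp
  qed
  define S where "S k = (\<Sum>j<k. A j)" for k
  define \<sigma> where "\<sigma> k = S k / A k" for k
  have S0: "S k \<ge> 0" for k unfolding S_def using A(1) by (intro sum_nonneg) (auto intro: less_imp_le)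
  have \<sigma>0: "\<sigma> k \<ge> 0" for k using S0 A(1)[of k] by (simp add: \<sigma>_def)
  have "\<forall>\<^sub>F k in sequentially. C / (s - r) \<le> A k" using A(2) by (simp add: filterlim_at_top)
  then obtain M' where M': "\<And>k. k \<ge> M' \<Longrightarrow> C / (s - r) \<le> A k" by (auto simp: eventually_sequentially)
  define K where "K = max M M'"
  have main: "r * w * A (Suc k) < (1 - r - w) * A k - w * S k" if "k \<ge> K" for k
  proof -
    have "C \<le> (s - r) * A k" using M'[of k] that r by (simp add: K_def divide_le_eq mult.commute)
    moreover have "(1 - w) * A k - w * S k + C > s * (A k + w * A (Suc k))"
      using neg that unfolding S_def K_def by force
    moreover have "r * (w * A (Suc k)) \<le> s * (w * A (Suc k))"
      using r A(1)[of "Suc k"] w by (intro mult_right_mono) auto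
    ultimately show ?thesis by (simp add: algebra_simps)
  qed
  define q where "q = 1 - r - w"
  \<comment> \<open>The positivity of \<open>q - w * \<sigma> k\<close> bounds
    \<open>\<sigma>\<close> by \<open>q / w\<close>, which in the end contradicts its linear
    growth.\<close>
  have D: "0 < q - w * \<sigma> k \<and> A (Suc k) * (r * w) < A k * (q - w * \<sigma> k)" if "k \<ge> K" for k
  proof -
    have "A k * (q - w * \<sigma> k) = (1 - r - w) * A k - w * S k"
      using A(1)[of k] by (simp add: q_def \<sigma>_def field_simps)
    then have *: "A (Suc k) * (r * w) < A k * (q - w * \<sigma> k)" using main[OF that] by (simp add: mult_ac)
    moreover have "0 < A (Suc k) * (r * w)" using A(1)[of "Suc k"] r0 w by simp
    ultimately have "0 < A k * (q - w * \<sigma> k)" by linarith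
    with * show ?thesis using A(1)[of k] by (simp add: zero_less_mult_iff)
  qed
  have qpos: "q > 0" using D[of K] \<sigma>0[of K] w by (smt (verit) mult_nonneg_nonneg order_refl)
  \<comment> \<open>Since \<open>B = r * w - q\<close>, the quadratic at \<open>\<sigma> k\<close>
    equals \<open>(\<sigma> k + 1) * (r * w) - \<sigma> k * (q - w * \<sigma> k)\<close>, the
    numerator of a lower bound for the increment.\<close>
  have step: "\<sigma> k + c / q \<le> \<sigma> (Suc k)" if "k \<ge> K" for k
  proof -
    let ?D = "q - w * \<sigma> k"
    have Dk: "0 < ?D" "A (Suc k) * (r * w) < A k * ?D" using D[OF that] by auto
    have "\<sigma> k + c / q \<le> \<sigma> k + c / ?D"
      using Dk \<sigma>0[of k] w c qpos by (intro add_left_mono divide_left_mono) auto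
    also have "\<dots> \<le> \<sigma> k + (w * (\<sigma> k)\<^sup>2 + B * \<sigma> k + r * w) / ?D"
      using quad Dk by (intro add_left_mono divide_right_mono) auto
    also have "\<dots> = (\<sigma> k + 1) * (r * w) / ?D"
      using Dk unfolding B_def q_def by (simp add: field_simps power2_eq_square)
    also have "\<dots> \<le> (\<sigma> k + 1) * (A k / A (Suc k))"
    proof -
      have "r * w / ?D \<le> A k / A (Suc k)" 
        using Dk A(1)[of "Suc k"] by (simp add: divide_le_eq le_divide_eq mult_ac less_imp_le)
      then have "(\<sigma> k + 1) * (r * w / ?D) \<le> (\<sigma> k + 1) * (A k / A (Suc k))"
        using \<sigma>0[of k] by (intro mult_left_mono) auto
      then show ?thesis by simp
    qed
    also have "\<dots> = \<sigma> (Suc k)"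
    proof -
      have "A k \<noteq> 0" using A(1)[of k] by simp
      then have "\<sigma> k + 1 = S (Suc k) / A k" by (simp add: \<sigma>_def S_def add_divide_distrib)
      with \<open>A k \<noteq> 0\<close> show ?thesis by (simp add: \<sigma>_def)
    qed
    finally show ?thesis .
  qed
  have "real n * (c / q) \<le> \<sigma> (K + n)" for n
  proof (induction n)
    case (Suc n)
    then show ?case using step[of "K + n"] by (simp add: algebra_simps)
  qed (use \<sigma>0 in auto)
  moreover have "\<sigma> (K + n) \<le> q / w" for n using D[of "K + n"] w by (simp add: field_simps)
  ultimately have "real n * (c / q) \<le> q / w" for n using order_trans by blast
  moreover obtain n where "q / w < real n * (c / q)"
    using reals_Archimedean3[of "c / q" ] c qpos by auto
  ultimately show False by (meson not_le)
qed

text \<open>The sequence consists of successive record minima of \<open>d\<close>. If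
  \<open>m\<close> is the record after \<open>n\<close>, then \<open>d n\<close> is the minimum of
  \<open>d\<close> over \<open>{1..m - 1}\<close>, so the hypothesis at \<open>N = m - 1\<close>
  gives \<open>d n < e m\<close>.\<close>

lemma best_approximation_chain:
  fixes d e :: "nat \<Rightarrow> real"
  assumes d: "\<And>n. n \<ge> 1 \<Longrightarrow> d n > 0"
    and e: "e \<longlonglongrightarrow> 0"
    and ev: "\<forall>\<^sub>F N in sequentially. \<exists>n\<in>{1..N}. d n < e (Suc N)"
  obtains n where "strict_mono n" "n 0 \<ge> 1" "\<And>k. d (n k) < e (n (Suc k))" "\<And>k. d (n (Suc k)) < d (n k)"
proof -
  obtain N0 where N0: "\<And>N. N \<ge> N0 \<Longrightarrow> \<exists>n\<in>{1..N}. d n < e (Suc N)"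
    using ev by (auto simp: eventually_sequentially)
  have small: "\<exists>m>n. d m < \<mu>" if "\<mu> > 0" for n \<mu>
  proof -
    \<comment> \<open>An index with value below \<open>\<nu>\<close> cannot lie in
      \<open>{1..n}\<close>.\<close>
    define \<nu> where "\<nu> = Min (insert \<mu> (d ` {1..n}))"
    have "\<nu> > 0" using that d by (auto simp: \<nu>_def)
    then have "\<forall>\<^sub>F N in sequentially. e N < \<nu>" using e by (simp add: order_tendstoD)
    then obtain N1 where N1: "\<And>N. N \<ge> N1 \<Longrightarrow> e N < \<nu>" by (auto simp: eventually_sequentially)
    obtain m where m: "m \<in> {1..max N0 N1}" "d m < e (Suc (max N0 N1))" using N0[of "max N0 N1"] by auto
    moreover have "e (Suc (max N0 N1)) < \<nu>" by (rule N1) simp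
    ultimately have "d m < \<nu>" by linarith
    then have "d m < \<mu>" "m \<notin> {1..n}" by (auto simp: \<nu>_def)
    then show ?thesis using m by (intro exI[of _ m]) auto
  qed
  \<comment> \<open>The clause \<open>n \<ge> N0\<close> makes \<open>N0\<close> applicable at the
    predecessor of the next record.\<close>
  define rcd where "rcd n \<longleftrightarrow> n \<ge> 1 \<and> n \<ge> N0 \<and> (\<forall>j\<in>{1..<n}. d n < d j)" for n
  have "\<exists>n. rcd n"
  proof -
    \<comment> \<open>The first index beyond \<open>N0\<close> that undercuts \<open>\<mu>\<close>
      is smaller than all earlier values, including those up to \<open>N0\<close>.\<close>
    define \<mu> where "\<mu> = Min (insert 1 (d ` {1..N0}))"
    have "\<mu> > 0" using d by (auto simp: \<mu>_def)
    then have ex: "\<exists>m>N0. d m < \<mu>" by (rule small)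
    define m where "m = (LEAST m. m > N0 \<and> d m < \<mu>)"
    have m: "m > N0" "d m < \<mu>" using LeastI_ex[OF ex] by (auto simp: m_def)
    have "d m < d j" if "j \<in> {1..<m}" for j
    proof (cases "j \<le> N0")
      case True
      then have "\<mu> \<le> d j" using that unfolding \<mu>_def by (intro Min_le) auto
      with m show ?thesis by simp
    next
      case False
      then have "\<not> d j < \<mu>" using not_less_Least[of j "\<lambda>m. m > N0 \<and> d m < \<mu>"] that by (auto simp: m_def)
      with m show ?thesis by simp
    qed
    then have "rcd m" using m by (auto simp: rcd_def)
    then show ?thesis ..
  qed
  moreover have "\<exists>m. rcd m \<and> n < m \<and> d n < e m \<and> d m < d n" if n: "rcd n" for n
  proof -
    have ex: "\<exists>m>n. d m < d n" by (rule small) (use d n in \<open>auto simp: rcd_def\<close>)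
    define m where "m = (LEAST m. m > n \<and> d m < d n)"
    have m: "m > n" "d m < d n" using LeastI_ex[OF ex] by (auto simp: m_def)
    have ge: "d n \<le> d j" if "j \<in> {1..<m}" for j
    proof (cases "j \<le> n")
      case True
      then show ?thesis using n that unfolding rcd_def
        by (cases "j = n") (auto intro: less_imp_le)
    next
      case False
      then show ?thesis using not_less_Least[of j "\<lambda>m. m > n \<and> d m < d n"] that by (auto simp: m_def)
    qed
    have "N0 \<le> m - 1" using n m by (auto simp: rcd_def)
    then obtain j where j: "j \<in> {1..m - 1}" "d j < e (Suc (m - 1))" using N0 by blast
    moreover have "d n \<le> d j" by (rule ge) (use j m in auto)
    ultimately have "d n < e m" using m by simp
    moreover have "rcd m" using m ge n unfolding rcd_def by (auto intro: less_le_trans)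
    ultimately show ?thesis using m by blast
  qed
  ultimately obtain n where "\<And>k. rcd (n k)" 
     "\<And>k. n k < n (Suc k) \<and> d (n k) < e (n (Suc k)) \<and> d (n (Suc k)) < d (n k)"
    using dependent_nat_choice[of "\<lambda>_. rcd" "\<lambda>_ n m. n < m \<and> d n < e m \<and> d m < d n"] by metis
  then show ?thesis by (intro that[of n]) (auto simp: strict_mono_Suc_iff rcd_def)
qed

section \<open>Distance to the nearest integer and integers in an interval\<close>

lemma dist_nearest_int_le: "dist_nearest_int x \<le> \<bar>x - of_int p\<bar>"
  unfolding dist_nearest_int_def using round_diff_minimal[of x p] by (simp add: abs_minus_commute)

lemma dist_nearest_int_le_half: "dist_nearest_int x \<le> 1 / 2"
  unfolding dist_nearest_int_def using of_int_round_abs_le[of x] by (simp add: abs_minus_commute)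

lemma dist_nearest_int_nonneg: "0 \<le> dist_nearest_int x"
  by (simp add: dist_nearest_int_def)

text \<open>As long as the multiplied error is below 1/2, \<open>c\<close> times the nearest integer
  to \<open>x\<close> is still the nearest integer to \<open>c * x\<close>.\<close>

lemma dist_nearest_int_mult:
  assumes "real c * dist_nearest_int x < 1 / 2"
  shows "dist_nearest_int (real c * x) = real c * dist_nearest_int x"
proof -
  have eq: "real c * dist_nearest_int x = \<bar>real c * x - of_int (int c * round x)\<bar>"
    unfolding dist_nearest_int_def by (simp add: abs_mult flip: right_diff_distrib)
  with assms have "round (real c * x) = int c * round x" by (intro round_unique') simp
  with eq show ?thesis by (simp add: dist_nearest_int_def)
qed

lemma int_ball_card:
  assumes "0 \<le> \<rho>"
  shows "finite {p::int. \<bar>of_int p - y\<bar> < \<rho>}" "real (card {p::int. \<bar>of_int p - y\<bar> < \<rho>}) \<le> 2 * \<rho> + 1"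
proof -
  have sub: "{p::int. \<bar>of_int p - y\<bar> < \<rho>} \<subseteq> {\<lceil>y - \<rho>\<rceil>..\<lfloor>y + \<rho>\<rfloor>}"
    by (auto simp: ceiling_le_iff le_floor_iff)
  then show "finite {p::int. \<bar>of_int p - y\<bar> < \<rho>}" by (rule finite_subset) simp
  have "card {p::int. \<bar>of_int p - y\<bar> < \<rho>} \<le> nat (\<lfloor>y + \<rho>\<rfloor> - \<lceil>y - \<rho>\<rceil> + 1)"
    using card_mono[OF _ sub] by simp
  moreover have "real (nat (\<lfloor>y + \<rho>\<rfloor> - \<lceil>y - \<rho>\<rceil> + 1)) \<le> 2 * \<rho> + 1" using assms by linarith
  ultimately show "real (card {p::int. \<bar>of_int p - y\<bar> < \<rho>}) \<le> 2 * \<rho> + 1" by linarith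
qed

text \<open>Chains are listed with the most recent index first. \<open>chain_entropy\<close> is, up to an additive error
  proportional to the length, the logarithm to base \<open>b\<close> of the number of nearest integers to
  \<open>b ^ a m * \<xi>\<close>, for \<open>m\<close> the head of the chain, when \<open>\<xi>\<close> runs through a unit interval subject to the chain.\<close>

fun approx_chain :: "nat \<Rightarrow> (nat \<Rightarrow> nat) \<Rightarrow> real \<Rightarrow> nat list \<Rightarrow> real \<Rightarrow> bool" where
  "approx_chain b a w [] \<xi> = False"
| "approx_chain b a w [n] \<xi> = True"
| "approx_chain b a w (m # n # ns) \<xi> =
     (dist_nearest_int (real b ^ a n * \<xi>) < real b powr (- w * a m) \<and>
      real (a n) - 1 \<le> (1 - w) * a m \<and> approx_chain b a w (n # ns) \<xi>)"

fun chain_entropy :: "(nat \<Rightarrow> nat) \<Rightarrow> real \<Rightarrow> nat list \<Rightarrow> real" where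
  "chain_entropy a w [] = 0"
| "chain_entropy a w [n] = a n"
| "chain_entropy a w (m # n # ns) = chain_entropy a w (n # ns) + (1 - w) * a m - a n"

definition chain_centres :: "nat \<Rightarrow> (nat \<Rightarrow> nat) \<Rightarrow> real \<Rightarrow> int \<Rightarrow> nat list \<Rightarrow> int set" where
  "chain_centres b a w z ns = {p. \<exists>\<xi>\<in>{of_int z..of_int z + 1}.
     approx_chain b a w ns \<xi> \<and> p = round (real b ^ a (hd ns) * \<xi>)}"

text \<open>If \<open>p\<close> is the integer nearest to \<open>b ^ a n * \<xi>\<close>, then
  \<open>b ^ a m * \<xi>\<close> lies within \<open>b powr g\<close> of
  \<open>b powr (a m - a n) * p\<close>, so \<open>p\<close> has at most
  \<open>2 * b powr g + 2\<close> successors. The gap condition in \<open>approx_chain\<close> gives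
  \<open>b powr g \<ge> 1 / b\<close>, so the additive constant is absorbed by the factor
  \<open>2 * b + 2\<close>.\<close>

lemma chain_centres_card:
  assumes b: "b \<ge> 2"
  shows "finite (chain_centres b a w z ns) \<and>
    real (card (chain_centres b a w z ns)) \<le> (2 * real b + 2) ^ length ns * real b powr chain_entropy a w ns"
proof (induction a w ns rule: chain_entropy.induct)
  case (1 a w)
  then show ?case by (simp add: chain_centres_def)
next
  case (2 a w n)
  define \<beta> where "\<beta> = real b ^ a n"
  have \<beta>: "\<beta> \<ge> 1" using b by (simp add: \<beta>_def)
  have "chain_centres b a w z [n] \<subseteq> {p. \<bar>of_int p - \<beta> * (z + 1/2)\<bar> < \<beta> / 2 + 1}"
  proof (clarsimp simp: chain_centres_def simp flip: \<beta>_def)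
    fix \<xi> assume \<xi>: "real_of_int z \<le> \<xi>" "\<xi> \<le> real_of_int z + 1"
    have "\<bar>of_int (round (\<beta> * \<xi>)) - \<beta> * \<xi>\<bar> \<le> 1 / 2" by (rule of_int_round_abs_le)
    moreover have "\<bar>\<beta> * \<xi> - \<beta> * (z + 1/2)\<bar> \<le> \<beta> * (1/2)"
    proof -
      have "\<bar>\<xi> - (z + 1/2)\<bar> \<le> 1 / 2" using \<xi> by linarith
      then show ?thesis
        unfolding right_diff_distrib[symmetric] abs_mult using \<beta> by (intro mult_mono) auto
    qed
    ultimately show "\<bar>of_int (round (\<beta> * \<xi>)) - \<beta> * (z + 1/2)\<bar> < \<beta> / 2 + 1" by linarith
  qed
  moreover have "0 \<le> \<beta> / 2 + 1" using \<beta> by simp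
  note ball = int_ball_card[OF this, of "\<beta> * (z + 1/2)"]
  ultimately have fin: "finite (chain_centres b a w z [n])"
    and c: "card (chain_centres b a w z [n]) \<le> card {p::int. \<bar>of_int p - \<beta> * (z + 1/2)\<bar> < \<beta> / 2 + 1}"
    using ball(1) by (auto intro: finite_subset card_mono)
  from c ball(2) have "real (card (chain_centres b a w z [n])) \<le> \<beta> + 3" by simp
  also have "\<dots> \<le> (2 * real b + 2) * \<beta>"
  proof -
    have "6 * \<beta> \<le> (2 * real b + 2) * \<beta>" using b \<beta> by (intro mult_right_mono) auto
    then show ?thesis using \<beta> by linarith
  qed
  finally show ?case using fin b by (simp add: \<beta>_def powr_realpow)
next
  case (3 a w m n ns)
  define R where "R = chain_centres b a w z (n # ns)"
  define g where "g = (1 - w) * a m - a n"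
  have IH: "finite R" "real (card R) \<le> (2 * real b + 2) ^ length (n # ns) * real b powr chain_entropy a w (n # ns)"
    using 3 by (auto simp: R_def)
  show ?case
  proof (cases "real (a n) - 1 \<le> (1 - w) * a m")
    case False
    then have "chain_centres b a w z (m # n # ns) = {}" by (auto simp: chain_centres_def)
    then show ?thesis by simp
  next
    case True
    define c where "c = real b powr (real (a m) - a n)"
    define \<rho> where "\<rho> = real b powr g + 1 / 2"
    have "real b powr (-1) \<le> real b powr g" using True b by (intro powr_mono) (auto simp: g_def)
    then have bg: "1 \<le> real b * real b powr g" using b by (simp add: powr_minus field_simps)
    have \<rho>: "0 \<le> \<rho>" by (simp add: \<rho>_def add_nonneg_nonneg)
    have sub: "chain_centres b a w z (m # n # ns) \<subseteq> (\<Union>p\<in>R. {q. \<bar>of_int q - c * of_int p\<bar> < \<rho>})"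
    proof
      fix q assume "q \<in> chain_centres b a w z (m # n # ns)"
      then obtain \<xi> where \<xi>: "\<xi> \<in> {of_int z..of_int z + 1}" "q = round (real b ^ a m * \<xi>)"
        "dist_nearest_int (real b ^ a n * \<xi>) < real b powr (- w * a m)" "approx_chain b a w (n # ns) \<xi>"
        by (auto simp: chain_centres_def)
      define p where "p = round (real b ^ a n * \<xi>)"
      have p: "p \<in> R" using \<xi> by (auto simp: R_def chain_centres_def p_def)
      have cb: "c * real b ^ a n = real b ^ a m"
        using b by (simp add: c_def powr_diff powr_realpow)
      have "c * dist_nearest_int (real b ^ a n * \<xi>) < c * real b powr (- w * a m)"
        using \<xi>(3) b by (intro mult_strict_left_mono) (auto simp: c_def)
      also have "\<dots> = real b powr g"
        by (simp add: c_def g_def algebra_simps flip: powr_add)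
      also have "c * dist_nearest_int (real b ^ a n * \<xi>) = \<bar>c * (real b ^ a n * \<xi> - of_int p)\<bar>"
        by (simp add: dist_nearest_int_def abs_mult c_def p_def)
      also have "c * (real b ^ a n * \<xi> - of_int p) = real b ^ a m * \<xi> - c * of_int p"
        by (simp add: right_diff_distrib cb flip: mult.assoc)
      finally have "\<bar>real b ^ a m * \<xi> - c * of_int p\<bar> < real b powr g" .
      moreover have "\<bar>of_int q - real b ^ a m * \<xi>\<bar> \<le> 1 / 2" unfolding \<xi>(2) by (rule of_int_round_abs_le)
      ultimately have "\<bar>of_int q - c * of_int p\<bar> < \<rho>" unfolding \<rho>_def by linarith
      then show "q \<in> (\<Union>p\<in>R. {q. \<bar>of_int q - c * of_int p\<bar> < \<rho>})" using p by blast
    qed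
    have finU: "finite (\<Union>p\<in>R. {q::int. \<bar>of_int q - c * of_int p\<bar> < \<rho>})"
      using IH(1) int_ball_card(1)[OF \<rho>] by blast
    have "real (card (chain_centres b a w z (m # n # ns)))
        \<le> real (card (\<Union>p\<in>R. {q::int. \<bar>of_int q - c * of_int p\<bar> < \<rho>}))"
      using card_mono[OF finU sub] by simp
    also have "\<dots> \<le> (\<Sum>p\<in>R. real (card {q::int. \<bar>of_int q - c * of_int p\<bar> < \<rho>}))"
      using card_UN_le[OF IH(1), of "\<lambda>p. {q::int. \<bar>of_int q - c * of_int p\<bar> < \<rho>}"]
      by (simp flip: of_nat_sum)
    also have "\<dots> \<le> (\<Sum>p\<in>R. 2 * \<rho> + 1)" by (intro sum_mono int_ball_card(2) \<rho>)
    also have "\<dots> = real (card R) * (2 * \<rho> + 1)" by simp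
    also have "\<dots> \<le> real (card R) * ((2 * real b + 2) * real b powr g)"
      using bg unfolding \<rho>_def by (intro mult_left_mono) (auto simp: algebra_simps)
    also have "\<dots> \<le> ((2 * real b + 2) ^ length (n # ns) * real b powr chain_entropy a w (n # ns)) *
        ((2 * real b + 2) * real b powr g)"
      using IH(2) by (intro mult_right_mono) auto
    also have "\<dots> = (2 * real b + 2) ^ length (m # n # ns) * real b powr chain_entropy a w (m # n # ns)"
      using b by (simp add: g_def powr_add powr_diff add_diff_eq[symmetric] mult_ac)
    finally show ?thesis using finite_subset[OF sub finU] by blast
  qed
qed

text \<open>A decreasing list is determined by its set of entries.\<close>

lemma decreasing_lists_card:
  fixes m :: nat
  defines "L \<equiv> {ns :: nat list. sorted_wrt (>) ns \<and> set ns \<subseteq> {..<m}}"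
  shows "finite L" "card L \<le> 2 ^ m" "\<And>ns. ns \<in> L \<Longrightarrow> length ns \<le> m"
proof -
  have "L \<subseteq> (\<lambda>S. rev (sorted_list_of_set S)) ` Pow {..<m}"
  proof
    fix ns assume ns: "ns \<in> L"
    then have "sorted_wrt (<) (rev ns)" by (simp add: L_def sorted_wrt_rev)
    then have "sorted_list_of_set (set (rev ns)) = rev ns"
      by (intro sorted_list_of_set_unique[THEN iffD1]) (auto simp: strict_sorted_iff distinct_card)
    then have "ns = rev (sorted_list_of_set (set ns))" by simp
    then show "ns \<in> (\<lambda>S. rev (sorted_list_of_set S)) ` Pow {..<m}" using ns by (auto simp: L_def)
  qed
  then show "finite L" "card L \<le> 2 ^ m"
    using card_mono[of "(\<lambda>S. rev (sorted_list_of_set S)) ` Pow {..<m}" L]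
      card_image_le[of "Pow {..<m}" "\<lambda>S. rev (sorted_list_of_set S)"]
    by (auto simp: card_Pow intro: finite_subset)
next
  fix ns assume ns: "ns \<in> L"
  then have "sorted_wrt (<) (rev ns)" by (simp add: L_def sorted_wrt_rev)
  then have "distinct ns" using strict_sorted_iff[of "rev ns"] by auto
  then have "length ns = card (set ns)" by (simp add: distinct_card)
  also have "\<dots> \<le> card {..<m}" using ns by (intro card_mono) (auto simp: L_def)
  finally show "length ns \<le> m" by simp
qed

primrec index_list :: "(nat \<Rightarrow> nat) \<Rightarrow> nat \<Rightarrow> nat list" where
  "index_list n 0 = [n 0]"
| "index_list n (Suc k) = n (Suc k) # index_list n k"

lemma index_list_Cons: "index_list n k = n k # tl (index_list n k)"
  by (cases k) auto

text \<open>The sum telescopes up to a fraction \<open>w\<close> of each term. The last summand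
  arises because the first index is counted with full weight.\<close>

lemma index_list_entropy:
  "chain_entropy a w (index_list n k) = (1 - w) * a (n k) - w * (\<Sum>j<k. real (a (n j))) + w * a (n 0)"
proof (induction k)
  case (Suc k)
  obtain ns where "index_list n k = n k # ns" using index_list_Cons by blast
  then show ?case using Suc by (simp add: algebra_simps)
qed (simp add: algebra_simps)

lemma index_list_chain:
  assumes "\<And>k. dist_nearest_int (real b ^ a (n k) * \<xi>) < real b powr (- w * a (n (Suc k)))"
    "\<And>k. real (a (n k)) - 1 \<le> (1 - w) * a (n (Suc k))"
  shows "approx_chain b a w (index_list n k) \<xi>"
proof (induction k)
  case (Suc k)
  obtain ns where "index_list n k = n k # ns" using index_list_Cons by blast
  then show ?case using Suc assms by simp
qed simp

lemma index_list_sorted: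
  assumes "strict_mono n"
  shows "sorted_wrt (>) (index_list n k) \<and> set (index_list n k) = n ` {..k}"
  by (induction k) (use assms in \<open>auto simp: strict_mono_less atMost_Suc\<close>)

section \<open>The upper bound\<close>

locale lacunary =
  fixes b :: nat and a :: "nat \<Rightarrow> nat" and \<eta> :: real
  assumes b: "b \<ge> 2"
    and a_pos: "\<And>n. n \<ge> 1 \<Longrightarrow> a n > 0"
    and a_mono: "strict_mono_on {1..} a"
    and a_ratio: "(\<lambda>n. real (a (n + 1)) / real (a n)) \<longlonglongrightarrow> \<eta>"
    and eta: "1 < \<eta>"
begin

lemma a_less: "1 \<le> m \<Longrightarrow> m < n \<Longrightarrow> a m < a n"
  using a_mono by (auto simp: strict_mono_on_def)

lemma a_le: "1 \<le> m \<Longrightarrow> m \<le> n \<Longrightarrow> a m \<le> a n"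
  using a_less by (metis le_less)

lemma a_ge: "n \<le> a n" if "n \<ge> 1"
  using that by (induction n rule: dec_induct) (use a_pos[of 1] a_less[of _ "Suc _"] in \<open>force intro: le_less_trans\<close>)+

lemma a_at_top: "filterlim (\<lambda>n. real (a n)) at_top sequentially"
  by (rule filterlim_at_top_mono[OF filterlim_real_sequentially])
     (use a_ge in \<open>auto simp: eventually_sequentially\<close>)

text \<open>The gap is \<open>a n\<close> times a factor tending to
  \<open>\<eta> - 1 > 0\<close>.\<close>

lemma a_gap: "filterlim (\<lambda>n. real (a (Suc n)) - real (a n)) at_top sequentially"
proof -
  have "filterlim (\<lambda>n. (real (a (n + 1)) / real (a n) - 1) * real (a n)) at_top sequentially"
    by (rule filterlim_tendsto_pos_mult_at_top[OF tendsto_diff[OF a_ratio tendsto_const] _ a_at_top])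
       (use eta in auto)
  moreover have "\<forall>\<^sub>F n in sequentially. (real (a (n + 1)) / real (a n) - 1) * real (a n) = real (a (Suc n)) - real (a n)"
    using eventually_ge_at_top[of 1] by eventually_elim (use a_pos in \<open>fastforce simp: field_simps\<close>)
  ultimately show ?thesis using filterlim_cong[OF refl refl] by fastforce
qed

text \<open>Consecutive terms have the quotient \<open>K * b powr (- c * gap)\<close>, and the gaps
  diverge. Hence counts exponential in the index are harmless.\<close>

lemma cost_summable:
  fixes c K :: real
  assumes "c > 0" "K > 0"
  shows "summable (\<lambda>n. K ^ n * real b powr (- c * a n))"
proof -
  have "\<forall>\<^sub>F n in sequentially. log b (2 * K) / c \<le> real (a (Suc n)) - real (a n)"
    using a_gap by (simp add: filterlim_at_top)
  then obtain N where N: "\<And>n. n \<ge> N \<Longrightarrow> log b (2 * K) / c \<le> real (a (Suc n)) - real (a n)"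
    by (auto simp: eventually_sequentially)
  have "norm (K ^ Suc n * real b powr (- c * a (Suc n))) \<le> 1 / 2 * norm (K ^ n * real b powr (- c * a n))"
    if "n \<ge> N" for n
  proof -
    have "log b (2 * K) \<le> c * (real (a (Suc n)) - real (a n))"
      using N[OF that] assms by (simp add: divide_le_eq mult.commute)
    then have "2 * K \<le> b powr (c * (real (a (Suc n)) - real (a n)))"
      using assms b by (simp add: log_le_iff)
    then have "2 * K * b powr (- c * a (Suc n)) \<le> b powr (c * (real (a (Suc n)) - real (a n))) * b powr (- c * a (Suc n))"
      by (rule mult_right_mono) simp
    also have "\<dots> = b powr (- c * a n)" by (simp add: algebra_simps flip: powr_add)
    finally have "K ^ n * (2 * K * b powr (- c * a (Suc n))) \<le> K ^ n * b powr (- c * a n)"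
      using assms by (intro mult_left_mono) auto
    then show ?thesis using assms by (simp add: abs_mult algebra_simps)
  qed
  then show ?thesis by (intro summable_ratio_test[of "1/2" N]) auto
qed

lemma chain_set_null:
  assumes w: "0 < w" "w < 1" and s: "((1 - w) / (1 + w))\<^sup>2 < s"
  shows "hausdorff_measure s {\<xi>\<in>{real_of_int z..of_int z + 1}. \<exists>n. strict_mono n \<and> n 0 \<ge> 1 \<and>
     (\<forall>k. dist_nearest_int (real b ^ a (n k) * \<xi>) < real b powr (- w * a (n (Suc k)))) \<and>
     (\<forall>k. real (a (n k)) - 1 \<le> (1 - w) * a (n (Suc k)))} = 0"
proof -
  have s0: "s > 0" using s by (smt (verit) zero_le_power2)
  have "((1 - w) / (1 + w))\<^sup>2 < 1" using w by (simp add: power_less_one_iff abs_square_less_1)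
  \<comment> \<open>\<open>r < s\<close> makes the cost decay, and \<open>r < 1\<close> is demanded
    by \<open>chain_selection\<close>.\<close>
  then obtain r where r: "((1 - w) / (1 + w))\<^sup>2 < r" "r < min s 1" using dense[of "((1 - w) / (1 + w))\<^sup>2" "min s 1"] s by auto
  \<comment> \<open>Here \<open>m\<close> is the index that follows the head of the chain. It is not
    listed, but it determines the radius and the admissible entropy.\<close>
  define L where "L m = {ns. sorted_wrt (>) ns \<and> set ns \<subseteq> {..<m} \<and> ns \<noteq> [] \<and>
     chain_entropy a w ns \<le> r * (a (hd ns) + w * a m)}" for m
  define R where "R = chain_centres b a w z"
  define \<rho> where "\<rho> m ns = real b powr (- (a (hd ns) + w * a m))" for m ns
  define U where "U m = (\<lambda>(ns, p::int). cball (of_int p / real b ^ a (hd ns)) (\<rho> m ns))" for m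
  \<comment> \<open>The factor 2 pays for the choice of the list, \<open>2 * real b + 2\<close> for
    the constant in the number of centres.\<close>
  define K where "K = 2 * (2 * real b + 2)"
  have Lsub: "L m \<subseteq> {ns. sorted_wrt (>) ns \<and> set ns \<subseteq> {..<m}}" for m by (auto simp: L_def)
  have Lfin: "finite (L m)" for m using finite_subset[OF Lsub decreasing_lists_card(1)] .
  have Lcard: "real (card (L m)) \<le> 2 ^ m" for m
  proof -
    have "card (L m) \<le> 2 ^ m"
      using card_mono[OF decreasing_lists_card(1) Lsub, of m] decreasing_lists_card(2)[of m] by linarith
    then show ?thesis by (metis of_nat_le_iff of_nat_numeral of_nat_power)
  qed
  have Rfin: "finite (R ns)" for ns using chain_centres_card[OF b] by (simp add: R_def)
  have \<rho>0: "\<rho> m ns > 0" for m ns using b by (simp add: \<rho>_def)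
  show ?thesis
  proof (rule hausdorff_measure_zero_limsup[OF s0, where I = "\<lambda>m. Sigma (L m) R" and U = U
        and c = "\<lambda>m. 2 powr s * (K ^ m * real b powr (- ((s - r) * w) * a m))"])
    show "finite (Sigma (L m) R)" for m using Lfin Rfin by (rule finite_SigmaI)
    show "bounded (U m i)" for m i by (auto simp: U_def split: prod.splits)
    show "summable (\<lambda>m. 2 powr s * (K ^ m * real b powr (- ((s - r) * w) * a m)))"
      by (rule summable_mult[OF cost_summable]) (use r w in \<open>auto simp: K_def\<close>)
    fix m
    have "(\<Sum>i\<in>Sigma (L m) R. diameter (U m i) powr s) = (\<Sum>ns\<in>L m. \<Sum>p\<in>R ns. (2 * \<rho> m ns) powr s)"
      using Lfin Rfin \<rho>0
      by (subst sum.Sigma) (auto simp: U_def diameter_cball split: prod.splits intro!: sum.cong simp: less_imp_le not_less)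
    also have "\<dots> = (\<Sum>ns\<in>L m. card (R ns) * (2 powr s * \<rho> m ns powr s))"
      using \<rho>0 by (simp add: powr_mult less_imp_le)
    also have "\<dots> \<le> (\<Sum>ns\<in>L m. 2 powr s * ((2 * real b + 2) ^ m * real b powr (- ((s - r) * w) * a m)))"
    proof (rule sum_mono)
      fix ns assume ns: "ns \<in> L m"
      \<comment> \<open>The radius is \<open>b powr (- E)\<close>, and membership in
        \<open>L m\<close> bounds the entropy by \<open>r * E\<close>.\<close>
      define E where "E = a (hd ns) + w * a m"
      have "real (card (R ns)) \<le> (2 * real b + 2) ^ length ns * real b powr chain_entropy a w ns"
        using chain_centres_card[OF b] by (simp add: R_def)
      also have "\<dots> \<le> (2 * real b + 2) ^ m * real b powr (r * E)"
        using ns decreasing_lists_card(3)[of ns m] b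
        by (intro mult_mono power_increasing powr_mono) (auto simp: L_def E_def)
      finally have "real (card (R ns)) * \<rho> m ns powr s \<le> ((2 * real b + 2) ^ m * real b powr (r * E)) * \<rho> m ns powr s"
        by (rule mult_right_mono) simp
      also have "\<dots> = (2 * real b + 2) ^ m * (real b powr (r * E) * \<rho> m ns powr s)" by simp
      also have "real b powr (r * E) * \<rho> m ns powr s = real b powr (- (s - r) * E)"
        by (simp add: \<rho>_def powr_powr E_def[symmetric] algebra_simps flip: powr_add)
      also have "\<dots> \<le> real b powr (- ((s - r) * w) * a m)"
      proof (rule powr_mono)
        have "(s - r) * (w * a m) \<le> (s - r) * E" using r by (intro mult_left_mono) (auto simp: E_def)
        then show "- (s - r) * E \<le> - ((s - r) * w) * a m" by (simp add: algebra_simps)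
      qed (use b in auto)
      finally have "real (card (R ns)) * \<rho> m ns powr s \<le> (2 * real b + 2) ^ m * real b powr (- ((s - r) * w) * a m)"
        by (simp add: mult_left_mono)
      then have "2 powr s * (real (card (R ns)) * \<rho> m ns powr s)
          \<le> 2 powr s * ((2 * real b + 2) ^ m * real b powr (- ((s - r) * w) * a m))"
        by (rule mult_left_mono) simp
      then show "card (R ns) * (2 powr s * \<rho> m ns powr s)
         \<le> 2 powr s * ((2 * real b + 2) ^ m * real b powr (- ((s - r) * w) * a m))"
        by (simp only: mult_ac)
    qed
    also have "\<dots> = real (card (L m)) * (2 powr s * ((2 * real b + 2) ^ m * real b powr (- ((s - r) * w) * a m)))"
      by simp
    also have "\<dots> \<le> 2 ^ m * (2 powr s * ((2 * real b + 2) ^ m * real b powr (- ((s - r) * w) * a m)))"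
      using Lcard by (intro mult_right_mono) auto
    also have "\<dots> = 2 powr s * (K ^ m * real b powr (- ((s - r) * w) * a m))"
      unfolding K_def power_mult_distrib[of 2] by (simp only: mult_ac)
    finally show "(\<Sum>i\<in>Sigma (L m) R. diameter (U m i) powr s)
       \<le> 2 powr s * (K ^ m * real b powr (- ((s - r) * w) * a m))" .
  next
    fix \<xi> M
    assume "\<xi> \<in> {\<xi>\<in>{real_of_int z..of_int z + 1}. \<exists>n. strict_mono n \<and> n 0 \<ge> 1 \<and>
     (\<forall>k. dist_nearest_int (real b ^ a (n k) * \<xi>) < real b powr (- w * a (n (Suc k)))) \<and>
     (\<forall>k. real (a (n k)) - 1 \<le> (1 - w) * a (n (Suc k)))}"
    then obtain n where \<xi>: "\<xi> \<in> {real_of_int z..of_int z + 1}" and n: "strict_mono n" "n 0 \<ge> 1"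
      and d: "\<And>k. dist_nearest_int (real b ^ a (n k) * \<xi>) < real b powr (- w * a (n (Suc k)))"
      and gap: "\<And>k. real (a (n k)) - 1 \<le> (1 - w) * a (n (Suc k))" by blast
    have n1: "n k \<ge> 1" for k using n strict_mono_less_eq[of n 0 k] by (meson le0 le_trans)
    \<comment> \<open>The constant \<open>w * a (n 0)\<close> from \<open>index_list_entropy\<close>
      plays the part of \<open>C\<close> in \<open>chain_selection\<close>.\<close>
    have "\<exists>k\<ge>M. (1 - w) * a (n k) - w * (\<Sum>j<k. real (a (n j))) + w * a (n 0) \<le> r * (a (n k) + w * a (n (Suc k)))"
    proof (rule chain_selection[OF w r(1)])
      show "filterlim (\<lambda>k. real (a (n k))) at_top sequentially"
        by (rule filterlim_compose[OF a_at_top filterlim_subseq[OF n(1)]])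
    qed (use r n1 a_pos in auto)
    then obtain k where k: "k \<ge> M" "chain_entropy a w (index_list n k) \<le> r * (a (n k) + w * a (n (Suc k)))"
      by (auto simp: index_list_entropy)
    define m where "m = n (Suc k)"
    define ns where "ns = index_list n k"
    define p where "p = round (real b ^ a (n k) * \<xi>)"
    have hd: "hd ns = n k" "ns \<noteq> []" unfolding ns_def using index_list_Cons by (metis list.sel(1), metis list.discI)
    have "ns \<in> L m"
      using index_list_sorted[OF n(1), of k] k hd strict_mono_less[OF n(1)]
      by (auto simp: L_def ns_def[symmetric] m_def)
    moreover have "p \<in> R ns"
    proof -
      have "approx_chain b a w ns \<xi>" unfolding ns_def using d gap by (rule index_list_chain)
      then show ?thesis using \<xi> hd(1) unfolding R_def chain_centres_def p_def by auto
    qed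
    moreover have "\<xi> \<in> U m (ns, p)"
    proof -
      have "\<bar>real b ^ a (n k) * \<xi> - of_int p\<bar> < real b powr (- w * a m)"
        using d[of k] by (simp add: dist_nearest_int_def p_def m_def)
      then have "\<bar>real b ^ a (n k) * \<xi> - of_int p\<bar> / real b ^ a (n k) \<le> real b powr (- w * a m) / real b ^ a (n k)"
        by (intro divide_right_mono) auto
      also have "\<dots> = \<rho> m ns" using b by (simp add: \<rho>_def hd powr_diff powr_minus field_simps powr_add powr_realpow)
      also have "\<bar>real b ^ a (n k) * \<xi> - of_int p\<bar> / real b ^ a (n k) = \<bar>\<xi> - of_int p / real b ^ a (n k)\<bar>"
      proof -
        have "\<bar>real b ^ a (n k) * \<xi> - of_int p\<bar> / real b ^ a (n k) = \<bar>(real b ^ a (n k) * \<xi> - of_int p) / real b ^ a (n k)\<bar>"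
          by (simp add: abs_divide)
        also have "(real b ^ a (n k) * \<xi> - of_int p) / real b ^ a (n k) = \<xi> - of_int p / real b ^ a (n k)"
          using b by (simp add: diff_divide_distrib)
        finally show ?thesis .
      qed
      finally show ?thesis by (simp add: U_def hd dist_real_def abs_minus_commute)
    qed
    moreover have "M \<le> m" using k(1) strict_mono_imp_increasing[OF n(1), of "Suc k"] unfolding m_def by linarith
    ultimately show "\<exists>m\<ge>M. \<exists>i\<in>Sigma (L m) R. \<xi> \<in> U m i" by blast
  qed
qed

text \<open>The supremum defining the exponent need not be attained, hence the passage to a smaller
  \<open>u\<close>.\<close>

lemma uniform_set_geD:
  assumes "\<xi> \<in> uniform_set_ge b a v" "u < v"
  shows "\<forall>\<^sub>F N in sequentially. \<exists>n\<in>{1..N}. dist_nearest_int (real b ^ a n * \<xi>) < real b powr (- u * a N)"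
proof -
  have "ereal u < uniform_exponent b a \<xi>"
    by (rule less_le_trans[of _ "ereal v"]) (use assms in \<open>auto simp: uniform_set_ge_def\<close>)
  then obtain u' where u': "u < u'" "\<forall>\<^sub>F N in sequentially.
      Min ((\<lambda>n. dist_nearest_int (real b ^ a n * \<xi>)) ` {1..N}) < (real b ^ a N) powr (- u')"
    unfolding uniform_exponent_def less_Sup_iff by auto
  from u'(2) eventually_ge_at_top[of 1] show ?thesis
  proof eventually_elim
    case (elim N)
    have "(real b ^ a N) powr (- u') = real b powr (- u' * a N)"
      using b by (simp add: powr_powr mult.commute flip: powr_realpow)
    also have "\<dots> \<le> real b powr (- u * a N)"
      using u'(1) b by (intro powr_mono) (auto intro: mult_right_mono)
    finally have "Min ((\<lambda>n. dist_nearest_int (real b ^ a n * \<xi>)) ` {1..N}) < real b powr (- u * a N)"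
      using elim by linarith
    then show ?case using elim(2) by (subst (asm) Min_less_iff) auto
  qed
qed

text \<open>By continuity some \<open>w < v / \<eta>\<close> still has its critical value below
  \<open>s\<close>. Points with a vanishing distance are rationals with a power of \<open>b\<close>
  as denominator and form a countable set; for all others the record minima give a chain as in
  \<open>chain_set_null\<close>.\<close>

lemma uniform_set_ge_null:
  assumes v: "0 < v" "v < \<eta>" and s: "((\<eta> - v) / (\<eta> + v))\<^sup>2 < s"
  shows "hausdorff_measure s (uniform_set_ge b a v) = 0"
proof -
  have s0: "s > 0" using s by (smt (verit) zero_le_power2)
  have "((\<lambda>w. ((1 - w) / (1 + w))\<^sup>2) \<longlongrightarrow> ((1 - v / \<eta>) / (1 + v / \<eta>))\<^sup>2) (at_left (v / \<eta>))"
    using v eta by (intro tendsto_intros) (auto simp: add_pos_pos field_simps)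
  moreover have "((1 - v / \<eta>) / (1 + v / \<eta>))\<^sup>2 = ((\<eta> - v) / (\<eta> + v))\<^sup>2"
    using v eta by (simp add: divide_simps)
  ultimately have "\<forall>\<^sub>F w in at_left (v / \<eta>). ((1 - w) / (1 + w))\<^sup>2 < s"
    using s by (simp add: order_tendstoD)
  moreover have "\<forall>\<^sub>F w in at_left (v / \<eta>). 0 < w \<and> w < v / \<eta>"
    using eventually_at_left_real[of 0 "v / \<eta>"] v eta by simp
  ultimately have "\<exists>w. ((1 - w) / (1 + w))\<^sup>2 < s \<and> 0 < w \<and> w < v / \<eta>"
    using eventually_happens[OF eventually_conj] by (metis (no_types, lifting) trivial_limit_at_left_real)
  then obtain w where w: "((1 - w) / (1 + w))\<^sup>2 < s" "0 < w" "w < v / \<eta>" by blast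
  have w1: "w < 1" using w(3) v eta by (smt (verit) divide_less_eq_1)
  have "\<eta> < v / w" using w eta by (simp add: field_simps)
  \<comment> \<open>Eventually \<open>a (N + 1) / a N < u / w\<close>, so a bound with exponent
    \<open>u\<close> at \<open>N\<close> becomes one with exponent \<open>w\<close> at
    \<open>N + 1\<close>.\<close>
  then obtain u where u: "\<eta> < u / w" "u < v" 
  proof -
    obtain t where "\<eta> < t" "t < v / w" using dense[OF \<open>\<eta> < v / w\<close>] by blast
    then show ?thesis using that[of "t * w"] w by (simp add: field_simps)
  qed
  define G where "G z = {\<xi>\<in>{real_of_int z..of_int z + 1}. \<exists>n. strict_mono n \<and> n 0 \<ge> 1 \<and>
     (\<forall>k. dist_nearest_int (real b ^ a (n k) * \<xi>) < real b powr (- w * a (n (Suc k)))) \<and>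
     (\<forall>k. real (a (n k)) - 1 \<le> (1 - w) * a (n (Suc k)))}" for z
  define Q where "Q = range (\<lambda>(p::int, n). of_int p / real b ^ a n)"
  have "uniform_set_ge b a v \<subseteq> Q \<union> (\<Union>i. G (from_nat i))"
  proof
    fix \<xi> assume \<xi>: "\<xi> \<in> uniform_set_ge b a v"
    show "\<xi> \<in> Q \<union> (\<Union>i. G (from_nat i))"
    proof (cases "\<exists>n. dist_nearest_int (real b ^ a n * \<xi>) = 0")
      case True
      then obtain n where "real b ^ a n * \<xi> = of_int (round (real b ^ a n * \<xi>))"
        by (auto simp: dist_nearest_int_def)
      then have "\<xi> = (\<lambda>(p::int, n). of_int p / real b ^ a n) (round (real b ^ a n * \<xi>), n)"
        using b by (simp add: field_simps)
      then show ?thesis unfolding Q_def by blast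
    next
      case False
      define d where "d n = dist_nearest_int (real b ^ a n * \<xi>)" for n
      have d0: "d n > 0" for n using False dist_nearest_int_nonneg[of "real b ^ a n * \<xi>"]
        by (auto simp: d_def less_le)
      have e0: "(\<lambda>N. real b powr (- w * a N)) \<longlonglongrightarrow> 0"
      proof -
        have "filterlim (\<lambda>N. w * real (a N)) at_top sequentially"
          by (rule filterlim_tendsto_pos_mult_at_top[OF tendsto_const w(2) a_at_top])
        then have "filterlim (\<lambda>N. - w * real (a N)) at_bot sequentially"
          by (simp add: filterlim_uminus_at_bot)
        moreover have "((\<lambda>x. real b powr x) \<longlongrightarrow> 0) at_bot"
        proof -
          have "((\<lambda>x. exp (ln (real b) * x)) \<longlongrightarrow> 0) at_bot"
            by (rule filterlim_compose[OF exp_at_bot])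
               (use b in \<open>auto intro!: filterlim_tendsto_pos_mult_at_bot[OF tendsto_const] filterlim_ident\<close>)
          then show ?thesis using b by (simp add: powr_def mult.commute)
        qed
        ultimately show ?thesis by (rule filterlim_compose[rotated])
      qed
      have ev: "\<forall>\<^sub>F N in sequentially. \<exists>n\<in>{1..N}. d n < real b powr (- w * a (Suc N))"
        using uniform_set_geD[OF \<xi> u(2)] order_tendstoD(2)[OF a_ratio u(1)] eventually_ge_at_top[of 1]
      proof eventually_elim
        case (elim N)
        have "w * real (a (Suc N)) \<le> u * real (a N)"
          using elim(2,3) a_pos[of N] w(2) by (simp add: field_simps)
        then have "real b powr (- u * a N) \<le> real b powr (- w * a (Suc N))" using b by (intro powr_mono) auto
        then show ?case using elim(1) unfolding d_def by (meson less_le_trans)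
      qed
      obtain n where n: "strict_mono n" "n 0 \<ge> 1"
         "\<And>k. d (n k) < real b powr (- w * a (n (Suc k)))" "\<And>k. d (n (Suc k)) < d (n k)"
        using best_approximation_chain[OF d0 e0 ev] by blast
      have n1: "n k \<ge> 1" for k using n strict_mono_less_eq[of n 0 k] by (meson le0 le_trans)
      \<comment> \<open>A smaller scaled distance would just be multiplied on passing to the next record, which is
        impossible as the next record is smaller.\<close>
      have gap: "real (a (n k)) - 1 \<le> (1 - w) * a (n (Suc k))" for k
      proof -
        define c where "c = b ^ (a (n (Suc k)) - a (n k))"
        have less: "a (n k) < a (n (Suc k))" using a_less[OF n1] n(1) by (simp add: strict_mono_Suc_iff)
        have c: "real c * real b ^ a (n k) = real b ^ a (n (Suc k))" "c \<ge> 1"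
          using less b by (auto simp: c_def simp flip: power_add)
        have "1 / 2 \<le> real c * d (n k)"
        proof (rule ccontr)
          assume "\<not> 1 / 2 \<le> real c * d (n k)"
          then have "dist_nearest_int (real c * (real b ^ a (n k) * \<xi>)) = real c * d (n k)"
            unfolding d_def by (intro dist_nearest_int_mult) simp
          then have "d (n (Suc k)) = real c * d (n k)" by (simp add: d_def c(1) flip: mult.assoc)
          moreover have "1 * d (n k) \<le> real c * d (n k)" 
            using c(2) d0[of "n k"] by (intro mult_right_mono) auto
          ultimately show False using n(4)[of k] by simp
        qed
        also have "\<dots> < real c * real b powr (- w * a (n (Suc k)))"
          using n(3) c(2) by (intro mult_strict_left_mono) auto
        also have "\<dots> = real b powr ((1 - w) * a (n (Suc k)) - a (n k))"
          using less b by (simp add: c_def of_nat_diff algebra_simps flip: powr_realpow powr_add)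
        finally have *: "1 / 2 < real b powr ((1 - w) * a (n (Suc k)) - a (n k))" .
        \<comment> \<open>The factor 1/2 is traded for one power of \<open>b\<close>; this is the
          \<open>- 1\<close> in the gap condition.\<close>
        have "real b powr (-1) \<le> 1 / 2" using b by (simp add: powr_minus field_simps)
        with * have "real b powr (-1) < real b powr ((1 - w) * a (n (Suc k)) - a (n k))" by linarith
        then have "-1 < (1 - w) * a (n (Suc k)) - a (n k)" by (subst (asm) powr_less_cancel_iff) (use b in auto)
        then show ?thesis by simp
      qed
      have "\<xi> \<in> G \<lfloor>\<xi>\<rfloor>" using n gap unfolding G_def d_def by (auto intro: less_imp_le)
      then have "\<xi> \<in> G (from_nat (to_nat \<lfloor>\<xi>\<rfloor>))" by simp
      then show ?thesis by blast
    qed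
  qed
  moreover have "hausdorff_measure s (Q \<union> (\<Union>i. G (from_nat i))) = 0"
  proof (intro hausdorff_measure_zero_Un hausdorff_measure_zero_UN)
    show "hausdorff_measure s Q = 0"
      by (rule hausdorff_measure_zero_countable) (use s0 in \<open>auto simp: Q_def\<close>)
    show "hausdorff_measure s (G (from_nat i)) = 0" for i
      unfolding G_def by (rule chain_set_null[OF w(2) w1 w(1)])
  qed
  ultimately show ?thesis using hausdorff_measure_zero_subset by blast
qed

end

section \<open>An embedding with prescribed blocks of zero digits\<close>

text \<open>\<open>spread b p q T\<close> places the last \<open>q\<close> base-\<open>b\<close> digits of \<open>T\<close> at the positions \<open>p 0, ..., p (q - 1)\<close>
  behind the point, with zeros elsewhere; \<open>digit_embedding\<close> does this to all digits of a real number.\<close>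

primrec spread :: "nat \<Rightarrow> (nat \<Rightarrow> nat) \<Rightarrow> nat \<Rightarrow> int \<Rightarrow> real" where
  "spread b p 0 T = 0"
| "spread b p (Suc q) T = spread b p q (T div int b) + of_int (T mod int b) / real b ^ p q"

definition expansion_digit :: "nat \<Rightarrow> real \<Rightarrow> nat \<Rightarrow> int" where
  "expansion_digit b t j = \<lfloor>real b ^ Suc j * t\<rfloor> mod int b"

definition digit_embedding :: "nat \<Rightarrow> (nat \<Rightarrow> nat) \<Rightarrow> real \<Rightarrow> real" where
  "digit_embedding b p t = (\<Sum>j. of_int (expansion_digit b t j) / real b ^ p j)"

text \<open>If the numbers without their last digit agree, the last digits differ by at least 1.
  Otherwise the gap from the earlier digits is at least \<open>b / b ^ p q\<close>, of which the
  last digit can consume at most \<open>(b - 1) / b ^ p q\<close>.\<close>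

lemma spread_less:
  assumes b: "b \<ge> 2" and p: "strict_mono p"
  shows "T < T' \<Longrightarrow> T div int b ^ q = T' div int b ^ q \<Longrightarrow>
    spread b p q T + 1 / real b ^ p (q - 1) \<le> spread b p q T'"
proof (induction q arbitrary: T T')
  case (Suc q)
  define D D' where "D = T mod int b" and "D' = T' mod int b"
  have D: "D \<le> int b - 1" "0 \<le> D'" using b by (simp_all add: D_def D'_def)
  have le: "T div int b \<le> T' div int b" using Suc.prems b by (intro zdiv_mono1) auto
  have eq: "T div int b div int b ^ q = T' div int b div int b ^ q"
    using Suc.prems b by (simp add: zdiv_zmult2_eq)
  show ?case
  proof (cases "T div int b = T' div int b")
    case True
    then have "D + 1 \<le> D'" using Suc.prems(1) unfolding D_def D'_def
      by (metis add_le_cancel_left div_mult_mod_eq linorder_not_le zless_imp_add1_zle add.assoc)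
    then have "real_of_int (D + 1) / real b ^ p q \<le> of_int D' / real b ^ p q"
      by (intro divide_right_mono) (simp_all only: of_int_le_iff, simp)
    with True show ?thesis by (simp add: D_def D'_def add_divide_distrib)
  next
    case False
    with le have lt: "T div int b < T' div int b" by simp
    have IH: "spread b p q (T div int b) + 1 / real b ^ p (q - 1) \<le> spread b p q (T' div int b)"
      by (rule Suc.IH[OF lt eq])
    \<comment> \<open>For \<open>q = 0\<close> the equation \<open>eq\<close> would identify the two
      quotients, so \<open>q - 1\<close> is a true predecessor.\<close>
    have "q \<noteq> 0" using False eq by (cases q) auto
    then have pq: "p (q - 1) + 1 \<le> p q" using p by (metis Suc_eq_plus1 Suc_leI diff_less less_one neq0_conv strict_mono_less)
    have "real b / real b ^ p q \<le> real b / real b ^ (p (q - 1) + 1)"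
      using b pq by (intro divide_left_mono power_increasing) auto
    then have 1: "real b / real b ^ p q \<le> 1 / real b ^ p (q - 1)" using b by simp
    have "(of_int D + 1) / real b ^ p q \<le> real b / real b ^ p q"
      using D(1) by (intro divide_right_mono) (linarith, simp)
    moreover have "0 \<le> of_int D' / real b ^ p q" using D(2) by simp
    ultimately show ?thesis using IH 1 by (simp add: D_def D'_def add_divide_distrib)
  qed
qed simp

lemma expansion_digit_bounds:
  assumes "b \<ge> 2"
  shows "0 \<le> expansion_digit b t j" "expansion_digit b t j \<le> int b - 1"
  using assms by (simp_all add: expansion_digit_def)

text \<open>Dropping the last digit of the floor at level \<open>q + 1\<close> gives the floor at
  level \<open>q\<close>, which matches the recursion of \<open>spread\<close>.\<close>

lemma partial_sum_spread:
  assumes b: "b \<ge> 2"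
  shows "(\<Sum>j<q. of_int (expansion_digit b t j) / real b ^ p j) = spread b p q \<lfloor>real b ^ q * t\<rfloor>"
proof (induction q)
  case (Suc q)
  have "\<lfloor>real b ^ q * t\<rfloor> = \<lfloor>real b ^ Suc q * t / real_of_int (int b)\<rfloor>" using b by simp
  also have "\<dots> = \<lfloor>real b ^ Suc q * t\<rfloor> div int b" by (rule floor_divide_real_eq_div) simp
  finally show ?case using Suc by (simp add: expansion_digit_def)
qed simp

text \<open>The remaining positions are at least \<open>m + 1, m + 2, ...\<close>, and digits
  \<open>b - 1\<close> at all of these sum to \<open>1 / b ^ m\<close>.\<close>

lemma embedding_tail:
  assumes b: "b \<ge> 2" and p: "strict_mono p" and m: "m < p q"
  shows "0 \<le> digit_embedding b p t - spread b p q \<lfloor>real b ^ q * t\<rfloor>"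
    and "digit_embedding b p t - spread b p q \<lfloor>real b ^ q * t\<rfloor> \<le> 1 / real b ^ m"
proof -
  define f where "f j = of_int (expansion_digit b t j) / real b ^ p j" for j
  define g where "g i = (real b - 1) / real b ^ (m + 1) * (1 / real b) ^ i" for i
  have f0: "0 \<le> f j" for j using expansion_digit_bounds[OF b] by (simp add: f_def)
  have pq: "m + 1 + i \<le> p (i + q)" for i
  proof (induction i)
    case (Suc i)
    moreover have "p (i + q) < p (Suc i + q)" using p by (simp add: strict_mono_less)
    ultimately show ?case by linarith
  qed (use m in simp)
  have fg: "f (i + q) \<le> g i" for i
  proof -
    have "real_of_int (expansion_digit b t (i + q)) \<le> real b - 1"
      using expansion_digit_bounds(2)[OF b, of t "i + q"] by linarith
    then have "f (i + q) \<le> (real b - 1) / real b ^ p (i + q)"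
      unfolding f_def by (intro divide_right_mono) auto
    also have "\<dots> \<le> (real b - 1) / real b ^ (m + 1 + i)"
      using b pq by (intro divide_left_mono power_increasing) auto
    also have "\<dots> = g i" by (simp add: g_def power_add power_divide)
    finally show ?thesis .
  qed
  have gs: "g sums (1 / real b ^ m)"
  proof -
    have "(\<lambda>i. (1 / real b) ^ i) sums (1 / (1 - 1 / real b))" using b by (intro geometric_sums) auto
    then have "g sums ((real b - 1) / real b ^ (m + 1) * (1 / (1 - 1 / real b)))"
      unfolding g_def by (rule sums_mult)
    moreover have "(real b - 1) / real b ^ (m + 1) * (1 / (1 - 1 / real b)) = 1 / real b ^ m"
      using b by (simp add: field_simps)
    ultimately show ?thesis by simp
  qed
  have sumq: "summable (\<lambda>i. f (i + q))"
    by (rule summable_comparison_test'[of g 0]) (use gs fg f0 in \<open>auto simp: sums_iff\<close>)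
  then have "summable f" by (simp add: summable_iff_shift)
  from suminf_split_initial_segment[OF this, of q]
  have split: "digit_embedding b p t - spread b p q \<lfloor>real b ^ q * t\<rfloor> = (\<Sum>i. f (i + q))"
    unfolding partial_sum_spread[OF b, symmetric] digit_embedding_def f_def by simp
  show "0 \<le> digit_embedding b p t - spread b p q \<lfloor>real b ^ q * t\<rfloor>"
    unfolding split using sumq f0 by (rule suminf_nonneg)
  have "(\<Sum>i. f (i + q)) \<le> (\<Sum>i. g i)" using fg sumq gs by (intro suminf_le) (auto simp: sums_iff)
  then show "digit_embedding b p t - spread b p q \<lfloor>real b ^ q * t\<rfloor> \<le> 1 / real b ^ m"
    unfolding split using gs by (simp add: sums_iff)
qed

text \<open>The factor 2 puts a full \<open>b\<close>-adic interval of order \<open>q\<close> between the two points, which rules out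
  that their images are close because of a carry.\<close>

lemma embedding_gap:
  assumes b: "b \<ge> 2" and p: "strict_mono p" and q: "q \<ge> 1"
    and t: "0 \<le> t" "t' < 1" "2 / real b ^ q \<le> t' - t"
  shows "1 / real b ^ p (q - 1) \<le> digit_embedding b p t' - digit_embedding b p t"
proof -
  define T T' where "T = \<lfloor>real b ^ q * t\<rfloor>" and "T' = \<lfloor>real b ^ q * t'\<rfloor>"
  have bq: "real b ^ q > 0" using b by simp
  have "2 \<le> real b ^ q * t' - real b ^ q * t" using t(3) bq by (simp add: field_simps)
  then have TT: "T + 2 \<le> T'" unfolding T_def T'_def by linarith
  have T0: "0 \<le> T" using t bq by (simp add: T_def)
  have "real b ^ q * t' < real b ^ q * 1" using t bq by (intro mult_strict_left_mono) auto
  then have T1: "T' < int b ^ q" by (simp add: T'_def floor_less_iff)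
  have div0: "X div int b ^ q = 0" if "0 \<le> X" "X \<le> T'" for X using that T1 by (simp add: div_pos_pos_trivial)
  \<comment> \<open>Of the two gaps obtained here and next, one pays for the tail of
    \<open>t\<close> and the other remains.\<close>
  have "spread b p q T + 1 / real b ^ p (q - 1) \<le> spread b p q (T + 1)"
    by (rule spread_less[OF b p]) (use div0 T0 TT in auto)
  moreover have "spread b p q (T + 1) + 1 / real b ^ p (q - 1) \<le> spread b p q T'"
    by (rule spread_less[OF b p]) (use div0 T0 TT in auto)
  moreover have m: "p (q - 1) < p q" using p q by (simp add: strict_mono_less)
  have "0 \<le> digit_embedding b p t' - spread b p q T'"
    "digit_embedding b p t - spread b p q T \<le> 1 / real b ^ p (q - 1)"
    using embedding_tail[OF b p m] by (auto simp: T_def T'_def)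
  ultimately show ?thesis by linarith
qed

text \<open>For the least \<open>q\<close> with \<open>2 / b ^ q \<le> t' - t\<close>, the distance
  of the points is at most \<open>2 / b ^ (q - 1)\<close>, while the images are at least
  \<open>1 / b ^ p (q - 1)\<close> apart; \<open>density\<close> compares the two exponents.\<close>

lemma embedding_inverse_holder:
  fixes s C :: real
  assumes b: "b \<ge> 2" and p: "strict_mono p" and s: "s > 0"
    and density: "\<And>q. s * p q \<le> q + C"
    and t: "t \<in> {0..<1}" "t' \<in> {0..<1}"
  shows "\<bar>t - t'\<bar> \<le> 2 * real b powr C * \<bar>digit_embedding b p t - digit_embedding b p t'\<bar> powr s"
  using t
proof (induction t t' rule: linorder_wlog)
  case (le t t')
  let ?h = "digit_embedding b p"
  show ?case
  proof (cases "t = t'")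
    case False
    with le have lt: "t < t'" by simp
    have "((\<lambda>q. 2 / real b ^ q) \<longlonglongrightarrow> 0)"
      using b LIMSEQ_inverse_realpow_zero[of "real b"] tendsto_mult[OF tendsto_const[of 2]] 
      by (fastforce simp: divide_inverse)
    then have "\<forall>\<^sub>F q in sequentially. 2 / real b ^ q < t' - t" using lt by (simp add: order_tendstoD)
    then have ex: "\<exists>q. 2 / real b ^ q \<le> t' - t" by (meson eventually_happens' less_imp_le sequentially_bot)
    define q where "q = (LEAST q. 2 / real b ^ q \<le> t' - t)"
    have q: "2 / real b ^ q \<le> t' - t" unfolding q_def using ex by (rule LeastI_ex)
    have q0: "q \<noteq> 0" using q le by (cases q) auto
    have "\<not> 2 / real b ^ (q - 1) \<le> t' - t"
      using not_less_Least[of "q - 1" "\<lambda>q. 2 / real b ^ q \<le> t' - t"] q0 by (auto simp: q_def)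
    then have "t' - t \<le> 2 * real b powr (- real (q - 1))"
      using b by (simp add: powr_minus powr_realpow divide_inverse)
    also have "\<dots> \<le> 2 * real b powr (C + - s * p (q - 1))"
      using density[of "q - 1"] b by (intro mult_left_mono powr_mono) auto
    also have "\<dots> = 2 * real b powr C * (1 / real b ^ p (q - 1)) powr s"
    proof -
      have "(1 / real b ^ p (q - 1)) powr s = real b powr (- s * p (q - 1))"
        using b by (simp add: powr_divide powr_powr powr_minus_divide mult.commute flip: powr_realpow)
      then show ?thesis by (simp only: powr_add mult.assoc)
    qed
    also have "\<dots> \<le> 2 * real b powr C * (?h t' - ?h t) powr s"
      using embedding_gap[OF b p _ _ _ q] q0 le s b by (intro mult_left_mono powr_mono2) auto
    also have "\<dots> \<le> 2 * real b powr C * \<bar>?h t' - ?h t\<bar> powr s"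
    proof -
      have "0 \<le> 1 / real b ^ p (q - 1)" by simp
      also have "\<dots> \<le> ?h t' - ?h t" using embedding_gap[OF b p _ _ _ q] q0 le by auto
      finally show ?thesis by simp
    qed
    finally show ?thesis using lt by (simp add: abs_minus_commute)
  qed simp
qed (simp add: abs_minus_commute)

text \<open>After multiplication by \<open>b ^ A\<close> the digits up to position \<open>A\<close>
  contribute an integer, and the others, all behind position \<open>A + r\<close>, contribute at
  most \<open>1 / b ^ r\<close>.\<close>

lemma embedding_approx:
  assumes b: "b \<ge> 2" and p: "strict_mono p" and gap: "\<And>q. p q \<le> A \<or> A + r < p q"
  shows "dist_nearest_int (real b ^ A * digit_embedding b p t) \<le> 1 / real b ^ r"
proof -
  have ex: "\<exists>q. A < p q"
    using strict_mono_imp_increasing[OF p, of "Suc A"] by (meson Suc_le_lessD)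
  define q where "q = (LEAST q. A < p q)"
  have "A < p q" unfolding q_def using ex by (rule LeastI_ex)
  then have q: "A + r < p q" using gap[of q] by auto
  have low: "p j \<le> A" if "j < q" for j using not_less_Least[of j "\<lambda>q. A < p q"] that by (auto simp: q_def)
  have "real b ^ A * (\<Sum>j<q. of_int (expansion_digit b t j) / real b ^ p j) =
      (\<Sum>j<q. of_int (expansion_digit b t j * int b ^ (A - p j)))"
    unfolding sum_distrib_left
  proof (rule sum.cong[OF refl])
    fix j assume "j \<in> {..<q}"
    then have "real b ^ A / real b ^ p j = real b ^ (A - p j)" using b low by (simp add: power_diff)
    then show "real b ^ A * (of_int (expansion_digit b t j) / real b ^ p j) =
        of_int (expansion_digit b t j * int b ^ (A - p j))" by simp (metis mult.commute times_divide_eq_right)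
  qed
  then have "real b ^ A * spread b p q \<lfloor>real b ^ q * t\<rfloor> = of_int (\<Sum>j<q. expansion_digit b t j * int b ^ (A - p j))"
    by (simp add: partial_sum_spread[OF b] del: of_int_mult)
  then obtain z where z: "real b ^ A * spread b p q \<lfloor>real b ^ q * t\<rfloor> = of_int z" by blast
  define e where "e = digit_embedding b p t - spread b p q \<lfloor>real b ^ q * t\<rfloor>"
  have e: "0 \<le> e" "e \<le> 1 / real b ^ (A + r)" using embedding_tail[OF b p q] by (auto simp: e_def)
  have "dist_nearest_int (real b ^ A * digit_embedding b p t) \<le> \<bar>real b ^ A * digit_embedding b p t - of_int z\<bar>"
    by (rule dist_nearest_int_le)
  also have "real b ^ A * digit_embedding b p t - of_int z = real b ^ A * e"
    using z by (simp add: e_def right_diff_distrib)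
  also have "\<bar>real b ^ A * e\<bar> = real b ^ A * e" using e(1) by simp
  also have "\<dots> \<le> real b ^ A * (1 / real b ^ (A + r))" using e(2) by (intro mult_left_mono) auto
  also have "\<dots> = 1 / real b ^ r" using b by (simp add: power_add)
  finally show ?thesis .
qed

section \<open>Density of the free positions\<close>

definition free_positions :: "(nat \<Rightarrow> nat) \<Rightarrow> (nat \<Rightarrow> nat) \<Rightarrow> nat set" where
  "free_positions A r = {x. \<forall>k. \<not> (A k < x \<and> x \<le> A k + r k)}"

text \<open>Blocks from index \<open>k\<close> on begin behind \<open>n\<close>, so a union bound
  over the first \<open>k\<close> blocks suffices. The \<open>+ 1\<close> accounts for position
  0.\<close>

lemma free_positions_count_lower:
  assumes A: "strict_mono A" and n: "n \<le> A k"
  shows "real n + 1 - (\<Sum>j<k. real (r j)) \<le> card {x \<in> free_positions A r. x \<le> n}"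
proof -
  have sub: "{..n} - {x \<in> free_positions A r. x \<le> n} \<subseteq> (\<Union>j<k. {A j<..A j + r j})"
  proof
    fix x assume "x \<in> {..n} - {x \<in> free_positions A r. x \<le> n}"
    then obtain j where j: "A j < x" "x \<le> A j + r j" "x \<le> n" by (auto simp: free_positions_def)
    then have "A j < A k" using n by linarith
    then have "j < k" using A by (simp add: strict_mono_less)
    with j show "x \<in> (\<Union>j<k. {A j<..A j + r j})" by auto
  qed
  have "card ({..n} - {x \<in> free_positions A r. x \<le> n}) \<le> card (\<Union>j<k. {A j<..A j + r j})"
    by (rule card_mono[OF _ sub]) auto
  also have "\<dots> \<le> (\<Sum>j<k. card {A j<..A j + r j})" by (rule card_UN_le) simp
  also have "\<dots> = (\<Sum>j<k. r j)" by simp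
  finally have "card ({..n} - {x \<in> free_positions A r. x \<le> n}) \<le> (\<Sum>j<k. r j)" .
  moreover have "card ({..n} - {x \<in> free_positions A r. x \<le> n}) = (n + 1) - card {x \<in> free_positions A r. x \<le> n}"
    by (subst card_Diff_subset) (auto intro: finite_subset[of _ "{..n}"])
  ultimately have "n + 1 \<le> (\<Sum>j<k. r j) + card {x \<in> free_positions A r. x \<le> n}" by linarith
  then have "real (n + 1) \<le> real ((\<Sum>j<k. r j) + card {x \<in> free_positions A r. x \<le> n})" by (simp only: of_nat_le_iff)
  then show ?thesis by simp
qed

text \<open>Inside a block the count stagnates, and between blocks it grows at rate at least
  \<open>s\<close>. The worst positions are therefore the ends of the blocks, where
  \<open>block\<close> applies.\<close>

lemma free_positions_count:
  fixes s C :: real and n :: nat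
  assumes A: "strict_mono A" and s: "0 \<le> s" "s \<le> 1" and C: "0 \<le> C"
    and block: "\<And>k. s * (real (A k) + r k) - C \<le> A k - (\<Sum>j<k. real (r j))"
  shows "s * n - C \<le> card {x \<in> free_positions A r. x \<le> n}"
proof (cases "n < A 0")
  case True
  then have "real n + 1 \<le> card {x \<in> free_positions A r. x \<le> n}"
    using free_positions_count_lower[OF A, of n 0 r] by simp
  moreover have "s * n \<le> 1 * real n" using s by (intro mult_right_mono) auto
  ultimately show ?thesis using C by simp
next
  case False
  have ex: "\<exists>k. n < A k"
    using strict_mono_imp_increasing[OF A, of "Suc n"] by (meson Suc_le_lessD)
  define k where "k = (LEAST k. n < A k)"
  have k: "n < A k" unfolding k_def using ex by (rule LeastI_ex)
  with False obtain m where m: "k = Suc m" by (cases k) auto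
  have Am: "A m \<le> n" using not_less_Least[of m "\<lambda>k. n < A k"] m by (auto simp: k_def)
  show ?thesis
  proof (cases "n \<le> A m + r m")
    case True
    have "s * n - C \<le> s * (real (A m) + r m) - C" using True s by (intro diff_right_mono mult_left_mono) linarith+
    also have "\<dots> \<le> card {x \<in> free_positions A r. x \<le> A m}"
      using block[of m] free_positions_count_lower[OF A, of "A m" m r] by linarith
    also have "\<dots> \<le> card {x \<in> free_positions A r. x \<le> n}"
      using Am by (intro of_nat_mono card_mono) auto
    finally show ?thesis .
  next
    case False
    have "s * (real n - A m - r m) \<le> 1 * (real n - A m - r m)" using s False by (intro mult_right_mono) linarith+
    then show ?thesis
      using block[of m] free_positions_count_lower[OF A, of n "Suc m" r] k m by (simp add: algebra_simps)
  qed
qed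

text \<open>At most \<open>q + 1\<close> elements lie up to the one numbered \<open>q\<close>, so a
  lower bound on the counting function is an upper bound on the enumeration.\<close>

lemma enumerate_density:
  fixes s C :: real
  assumes s: "s > 0" and P: "\<And>n::nat. s * n - C \<le> card {x \<in> P. x \<le> n}"
  shows "infinite P" "s * enumerate P q \<le> q + (C + 1)"
proof -
  show inf: "infinite P"
  proof
    assume fin: "finite P"
    obtain n :: nat where n: "(card P + C) / s < n" using reals_Archimedean2 by blast
    have "s * n - C \<le> card {x \<in> P. x \<le> n}" by (rule P)
    also have "\<dots> \<le> card P" using fin by (intro of_nat_mono card_mono) auto
    finally show False using n s by (simp add: field_simps)
  qed
  have "{x \<in> P. x \<le> enumerate P q} \<subseteq> enumerate P ` {..q}"
  proof
    fix x assume x: "x \<in> {x \<in> P. x \<le> enumerate P q}"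
    then obtain j where j: "enumerate P j = x" using enumerate_Ex[OF inf, of x] by auto
    then have "j \<le> q" using x strict_mono_less_eq[OF strict_mono_enumerate[OF inf]] by auto
    then show "x \<in> enumerate P ` {..q}" using j by auto
  qed
  then have "card {x \<in> P. x \<le> enumerate P q} \<le> card (enumerate P ` {..q})" by (rule card_mono[rotated]) simp
  also have "\<dots> \<le> q + 1" using card_image_le[of "{..q}" "enumerate P"] by simp
  finally have "real (card {x \<in> P. x \<le> enumerate P q}) \<le> real (q + 1)" by (simp only: of_nat_le_iff)
  then show "s * enumerate P q \<le> q + (C + 1)" using P[of "enumerate P q"] by simp
qed

text \<open>The finitely many exceptional values are absorbed into the constant.\<close>

lemma eventually_bounded_below:
  fixes f :: "nat \<Rightarrow> real"
  assumes "\<forall>\<^sub>F k in sequentially. c \<le> f k"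
  obtains C where "0 \<le> C" "\<And>k. - C \<le> f k"
proof -
  obtain K where K: "\<And>k. k \<ge> K \<Longrightarrow> c \<le> f k" using assms by (auto simp: eventually_sequentially)
  define C where "C = \<bar>c\<bar> + (\<Sum>j<K. \<bar>f j\<bar>)"
  have "0 \<le> (\<Sum>j<K. \<bar>f j\<bar>)" by (intro sum_nonneg) auto
  moreover have "\<bar>f k\<bar> \<le> (\<Sum>j<K. \<bar>f j\<bar>)" if "k < K" for k
    using that by (intro member_le_sum[of k "{..<K}" "\<lambda>j. \<bar>f j\<bar>"]) auto
  ultimately have "- C \<le> f k" for k using K[of k] unfolding C_def by (cases "k < K") force+
  moreover have "0 \<le> C" using \<open>0 \<le> (\<Sum>j<K. \<bar>f j\<bar>)\<close> by (simp add: C_def)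
  ultimately show ?thesis using that by blast
qed

section \<open>The lower bound and the theorem\<close>

context lacunary
begin

lemma ratio_power: "(\<lambda>n. real (a (n + j)) / real (a n)) \<longlonglongrightarrow> \<eta> ^ j"
proof (induction j)
  case 0
  have "\<forall>\<^sub>F n in sequentially. real (a (n + 0)) / real (a n) = 1"
    using eventually_ge_at_top[of 1] by eventually_elim (use a_pos in force)
  then show ?case by (simp add: tendsto_eventually)
next
  case (Suc j)
  have "(\<lambda>n. real (a (n + j + 1)) / real (a (n + j)) * (real (a (n + j)) / real (a n))) \<longlonglongrightarrow> \<eta> * \<eta> ^ j"
    by (intro tendsto_mult Suc LIMSEQ_ignore_initial_segment[OF a_ratio, of j])
  moreover have "\<forall>\<^sub>F n in sequentially. real (a (n + j + 1)) / real (a (n + j)) * (real (a (n + j)) / real (a n))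
      = real (a (n + Suc j)) / real (a n)"
    using eventually_ge_at_top[of 1]
  proof eventually_elim
    case (elim n)
    then have "a (n + j) > 0" using a_pos[of "n + j"] by simp
    then show ?case by simp
  qed
  ultimately show ?case using Lim_transform_eventually by fastforce
qed

text \<open>Covers the case outside \<open>uniform_set_geI\<close>: the distance is at most 1/2,
  while the bound with exponent 0 is 1.\<close>

lemma uniform_set_ge_0: "\<xi> \<in> uniform_set_ge b a 0"
proof -
  have "\<forall>\<^sub>F N in sequentially.
      Min ((\<lambda>n. dist_nearest_int (real b ^ a n * \<xi>)) ` {1..N}) < (real b ^ a N) powr (- 0)"
    using eventually_ge_at_top[of 1]
  proof eventually_elim
    case (elim N)
    have "Min ((\<lambda>n. dist_nearest_int (real b ^ a n * \<xi>)) ` {1..N}) \<le> dist_nearest_int (real b ^ a N * \<xi>)"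
      using elim by (intro Min_le) auto
    then show ?case using dist_nearest_int_le_half[of "real b ^ a N * \<xi>"] b by simp
  qed
  then show ?thesis unfolding uniform_set_ge_def uniform_exponent_def mem_Collect_eq
    by (intro Sup_upper) auto
qed

lemma uniform_set_geI:
  assumes v: "0 < v"
    and ev: "\<And>u::real. 0 \<le> u \<Longrightarrow> u < v \<Longrightarrow>
      \<forall>\<^sub>F N in sequentially. \<exists>n\<in>{1..N}. dist_nearest_int (real b ^ a n * \<xi>) < real b powr (- u * a N)"
  shows "\<xi> \<in> uniform_set_ge b a v"
proof -
  have low: "ereal u \<le> uniform_exponent b a \<xi>" if "0 \<le> u" "u < v" for u
    unfolding uniform_exponent_def
  proof (intro Sup_upper CollectI exI[of _ u] conjI refl)
    show "\<forall>\<^sub>F N in sequentially.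
      Min ((\<lambda>n. dist_nearest_int (real b ^ a n * \<xi>)) ` {1..N}) < (real b ^ a N) powr (- u)"
      using ev[OF that] eventually_ge_at_top[of 1]
    proof eventually_elim
      case (elim N)
      have "(real b ^ a N) powr (- u) = real b powr (- u * a N)"
        using b by (simp add: powr_powr mult.commute flip: powr_realpow)
      then show ?case using elim by (subst Min_less_iff) auto
    qed
  qed fact
  have "ereal v \<le> uniform_exponent b a \<xi>"
  proof (rule ccontr)
    assume "\<not> ereal v \<le> uniform_exponent b a \<xi>"
    then obtain u where u: "uniform_exponent b a \<xi> < ereal u" "ereal u < ereal v"
      using ereal_dense2 by (meson not_le)
    then have "ereal (max u 0) \<le> uniform_exponent b a \<xi>" using v by (intro low) auto
    moreover have "ereal u \<le> ereal (max u 0)" by simp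
    ultimately have "ereal u \<le> uniform_exponent b a \<xi>" by (rule order_trans[rotated])
    with u(1) show False by simp
  qed
  then show ?thesis by (simp add: uniform_set_ge_def)
qed

text \<open>The zeros behind \<open>A k\<close> number about
  \<open>v * a ((k + 1) * (l + 1) + l)\<close>, so the single index \<open>(k + 1) * (l + 1)\<close>
  serves all \<open>N\<close> up to the last one before the next block begins.\<close>

lemma uniform_embedding:
  assumes v: "v = \<eta> - 2 / \<eta> ^ l" "0 \<le> v"
  obtains p where "strict_mono p" "\<And>t. digit_embedding b p t \<in> uniform_set_ge b a v"
    "\<And>s::real. 0 < s \<Longrightarrow> s < 1 / (\<eta> ^ Suc l - 1)\<^sup>2 \<Longrightarrow> \<exists>C::real. \<forall>q. s * p q \<le> q + C"
proof -
  define i where "i = Suc l"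
  define x where "x = \<eta> ^ i"
  \<comment> \<open>The special form of \<open>v\<close> gives the blocks the limiting relative
    length \<open>x - 2\<close>, and \<open>0 \<le> v\<close> yields
    \<open>x \<ge> 2\<close>.\<close>
  have vx: "v * \<eta> ^ l = x - 2" using v eta by (simp add: x_def i_def field_simps)
  then have x2: "x \<ge> 2" using v(2) eta by (smt (verit) mult_nonneg_nonneg zero_le_power)
  define A where "A k = a (Suc k * i)" for k
  define r where "r k = nat \<lfloor>v * a (Suc k * i + l)\<rfloor>" for k
  have i1: "Suc k * i \<ge> 1" for k by (simp add: i_def)
  have A: "strict_mono A" unfolding strict_mono_Suc_iff A_def using a_less i1 by (simp add: i_def)
  have A0: "A k > 0" for k using a_pos[OF i1] by (simp add: A_def)
  have sub: "strict_mono (\<lambda>k. Suc k * i)" by (simp add: strict_mono_Suc_iff i_def)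
  have r_le: "real (r k) \<le> v * a (Suc k * i + l)" for k
    using v(2) by (simp add: r_def)
  have r_gt: "v * a (Suc k * i + l) < real (r k) + 1" for k
    unfolding r_def by linarith
  have lim_l: "(\<lambda>k. v * (a (Suc k * i + l) / A k)) \<longlonglongrightarrow> x - 2"
    using tendsto_mult[OF tendsto_const[of v] LIMSEQ_subseq_LIMSEQ[OF ratio_power[of l] sub]] vx
    by (simp add: A_def o_def)
  have lim_i: "(\<lambda>k. A (Suc k) / A k) \<longlonglongrightarrow> x"
    using LIMSEQ_subseq_LIMSEQ[OF ratio_power[of i] sub] by (simp add: A_def o_def x_def add.commute)
  define P where "P = free_positions A r"
  have dens: "\<exists>C::real. \<forall>n::nat. s * n - C \<le> card {y \<in> P. y \<le> n}" if s: "0 < s" "s < 1 / (x - 1)\<^sup>2" for s :: real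
  proof -
    \<comment> \<open>Up to position \<open>A k\<close> a proportion \<open>1 / (x - 1)\<close> of the digits is free, and the next block of zeros
      extends to about \<open>(x - 1) * A k\<close>.\<close>
    define e where "e = (1 / (x - 1) - s * (x - 1)) / (1 + s)"
    have "s * (x - 1) < 1 / (x - 1)" using s(2) x2 by (simp add: less_divide_eq power2_eq_square mult.assoc)
    then have e: "e > 0" using s by (simp add: e_def)
    \<comment> \<open>\<open>U\<close> slightly exceeds the limiting proportion
      \<open>(x - 2) / (x - 1)\<close> of zeros. The choice of \<open>e\<close> lets the errors in
      this proportion and in the block length use up exactly the available slack.\<close>
    define U where "U = (x - 2) / (x - 1) + e"
    have U: "1 - U - s * (x - 1 + e) = 0"
    proof -
      have "1 - (x - 2) / (x - 1) = 1 / (x - 1)" using x2 by (simp add: field_simps)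
      moreover have "e * (1 + s) = 1 / (x - 1) - s * (x - 1)" using s by (simp add: e_def)
      ultimately show ?thesis unfolding U_def by (simp add: algebra_simps)
    qed
    have "U * (x - 1) = x - 2 + e * (x - 1)" using x2 by (simp add: U_def field_simps)
    then have Ux: "x - 2 < U * (x - 1)" using e x2 by simp
    have "(\<lambda>k. U * (A (Suc k) / A k - 1) - v * (a (Suc k * i + l) / A k)) \<longlonglongrightarrow> U * (x - 1) - (x - 2)"
      by (intro tendsto_diff tendsto_mult tendsto_const lim_i lim_l)
    then have "\<forall>\<^sub>F k in sequentially. 0 < U * (A (Suc k) / A k - 1) - v * (a (Suc k * i + l) / A k)"
      using Ux by (intro order_tendstoD(1)) auto
    then have "\<forall>\<^sub>F k in sequentially. real (r k) \<le> U * (real (A (Suc k)) - A k)"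
    proof eventually_elim
      case (elim k)
      then have "v * (a (Suc k * i + l) / A k) * A k \<le> U * (A (Suc k) / A k - 1) * A k"
        by (intro mult_right_mono) auto
      also have "U * (A (Suc k) / A k - 1) * A k = U * (real (A (Suc k)) - A k)"
        using A0[of k] by (simp add: field_simps)
      also have "v * (a (Suc k * i + l) / A k) * A k = v * a (Suc k * i + l)"
        using A0[of k] by simp
      finally show ?case using r_le[of k] by linarith
    qed
    then obtain K where K: "\<And>k. k \<ge> K \<Longrightarrow> real (r k) \<le> U * (real (A (Suc k)) - A k)"
      by (auto simp: eventually_sequentially)
    \<comment> \<open>\<open>f\<close> is nondecreasing from \<open>K\<close> on, so the total
      length of the blocks before \<open>A k\<close> is at most \<open>U * A k\<close> up to a
      constant.\<close>
    define f where "f k = U * A k - (\<Sum>j<k. real (r j))" for k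
    have "f K \<le> f k" if "k \<ge> K" for k using that
    proof (induction k rule: dec_induct)
      case (step k)
      then show ?case using K[of k] by (simp add: f_def algebra_simps)
    qed simp
    then have "\<forall>\<^sub>F k in sequentially. f K \<le> f k" by (auto simp: eventually_sequentially)
    then obtain C1 :: real where C1: "0 \<le> C1" "\<And>k. - C1 \<le> f k" by (rule eventually_bounded_below) (rule that)
    have "\<forall>\<^sub>F k in sequentially. v * (a (Suc k * i + l) / A k) < x - 2 + e"
      using e by (intro order_tendstoD(2)[OF lim_l]) auto
    then have "\<forall>\<^sub>F k in sequentially. 0 \<le> (x - 2 + e) * A k - r k"
    proof eventually_elim
      case (elim k)
      then have "v * (a (Suc k * i + l) / A k) * A k \<le> (x - 2 + e) * A k" by (intro mult_right_mono) auto
      also have "v * (a (Suc k * i + l) / A k) * A k = v * a (Suc k * i + l)"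
        using A0[of k] by simp
      finally show ?case using r_le[of k] by linarith
    qed
    then obtain C2 :: real where C2: "0 \<le> C2" "\<And>k. - C2 \<le> (x - 2 + e) * A k - r k" by (rule eventually_bounded_below) (rule that)
    have "s * (real (A k) + r k) - (C1 + s * C2) \<le> A k - (\<Sum>j<k. real (r j))" for k
    proof -
      have "s * r k \<le> s * ((x - 2 + e) * A k + C2)" using C2(2)[of k] s by (intro mult_left_mono) auto
      moreover have "(1 - U - s * (x - 1 + e)) * A k = 0" by (simp add: U)
      ultimately show ?thesis using C1(2)[of k] by (simp add: f_def algebra_simps)
    qed
    moreover have "s \<le> 1"
    proof -
      have "1 \<le> (x - 1)\<^sup>2" using x2 by (simp add: one_le_power)
      then have "1 / (x - 1)\<^sup>2 \<le> 1" by (subst divide_le_eq_1_pos) linarith+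
      with s show ?thesis by linarith
    qed
    ultimately have "s * n - (C1 + s * C2) \<le> card {y \<in> P. y \<le> n}" for n :: nat
      unfolding P_def using s C1 C2 by (intro free_positions_count[OF A]) auto
    then show ?thesis by blast
  qed
  have inf: "infinite P"
  proof -
    define d where "d = 1 / (x - 1)\<^sup>2"
    have "0 < d" using x2 by (simp add: d_def)
    then have "0 < d / 2" "d / 2 < d" by simp_all
    then show ?thesis using dens[of "d / 2"] enumerate_density(1)[of "d / 2"] unfolding d_def by blast
  qed
  define p where "p = enumerate P"
  have p: "strict_mono p" unfolding p_def using inf by (rule strict_mono_enumerate)
  have gap: "p q \<le> A k \<or> A k + r k < p q" for q k
  proof -
    have "p q \<in> P" unfolding p_def using inf by (rule enumerate_in_set)
    then show ?thesis unfolding P_def free_positions_def mem_Collect_eq by (meson not_le)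
  qed
  show ?thesis
  proof (rule that[OF p])
    fix s :: real assume "0 < s" "s < 1 / (\<eta> ^ Suc l - 1)\<^sup>2"
    then obtain C :: real where C: "\<And>n::nat. s * n - C \<le> card {y \<in> P. y \<le> n}"
      using dens[of s] unfolding x_def i_def by blast
    then have "s * p q \<le> q + (C + 1)" for q
      unfolding p_def using enumerate_density(2)[OF \<open>0 < s\<close>] by blast
    then show "\<exists>C::real. \<forall>q. s * p q \<le> q + C" by blast
  next
    fix t
    show "digit_embedding b p t \<in> uniform_set_ge b a v"
    proof (cases "v = 0")
      case True
      then show ?thesis by (simp add: uniform_set_ge_0)
    next
      case False
      then have vpos: "0 < v" using v(2) by simp
      show ?thesis
      proof (rule uniform_set_geI[OF vpos])
        fix u assume u: "0 \<le> u" "u < v"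
        have "\<forall>\<^sub>F N in sequentially. 1 / (v - u) \<le> real (a N)" using a_at_top by (simp add: filterlim_at_top)
        then show "\<forall>\<^sub>F N in sequentially. \<exists>n\<in>{1..N}. dist_nearest_int (real b ^ a n * digit_embedding b p t) < real b powr (- u * a N)"
          using eventually_ge_at_top[of i]
        proof eventually_elim
          case (elim N)
          \<comment> \<open>\<open>Suc k * i\<close> is the largest multiple of \<open>i\<close> not
            exceeding \<open>N\<close>.\<close>
          define k where "k = N div i - 1"
          have "N div i \<ge> 1" using elim(2) by (simp add: i_def div_greater_zero_iff Suc_le_eq)
          then have k: "Suc k * i = N div i * i" by (simp add: k_def)
          have "N = N div i * i + N mod i" by simp
          moreover have "N mod i \<le> l" using mod_less_divisor[of i N] by (simp add: i_def less_Suc_eq_le)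
          ultimately have N: "Suc k * i \<le> N" "N \<le> Suc k * i + l" unfolding k by linarith+
          \<comment> \<open>This pays for the floor in the definition of \<open>r\<close>.\<close>
          have "1 \<le> (v - u) * a N" using elim(1) u by (simp add: divide_le_eq mult.commute)
          moreover have "v * a N \<le> v * a (Suc k * i + l)"
            using N a_le[of N "Suc k * i + l"] elim(2) vpos by (intro mult_left_mono) (auto simp: i_def)
          ultimately have "u * a N < r k" using r_gt[of k] by (simp add: algebra_simps)
          then have "real b powr (- real (r k)) < real b powr (- u * a N)"
            using b by (intro powr_less_mono) auto
          moreover have "dist_nearest_int (real b ^ A k * digit_embedding b p t) \<le> 1 / real b ^ r k"
            by (rule embedding_approx[OF b p gap])
          moreover have "1 / real b ^ r k = real b powr (- real (r k))"
            using b by (simp add: powr_minus_divide powr_realpow)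
          ultimately have "dist_nearest_int (real b ^ a (Suc k * i) * digit_embedding b p t) < real b powr (- u * a N)"
            by (simp add: A_def)
          moreover have "Suc k * i \<in> {1..N}" using i1 N by auto
          ultimately show ?case by blast
        qed
      qed
    qed
  qed
qed

lemma dim_formula_strict_antimono:
  assumes "0 \<le> u" "u < v" "v < \<eta>"
  shows "((\<eta> - v) / (\<eta> + v))\<^sup>2 < ((\<eta> - u) / (\<eta> + u))\<^sup>2"
proof (rule power_strict_mono)
  show "(\<eta> - v) / (\<eta> + v) < (\<eta> - u) / (\<eta> + u)"
    using assms eta by (intro frac_less) auto
qed (use assms eta in auto)

text \<open>Otherwise \<open>[0, 1)\<close> would be a countable union of negligible sets: the
  parameters whose image has exponent \<open>v\<close>, and those whose image has exponent at least
  \<open>w q\<close> for some \<open>w q > v\<close>.\<close>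

lemma uniform_set_eq_not_null:
  assumes v: "v = \<eta> - 2 / \<eta> ^ l" "0 \<le> v" and s: "0 < s" "s < ((\<eta> - v) / (\<eta> + v))\<^sup>2"
  shows "hausdorff_measure s (uniform_set_eq b a v) \<noteq> 0"
proof
  assume null: "hausdorff_measure s (uniform_set_eq b a v) = 0"
  define s0 where "s0 = ((\<eta> - v) / (\<eta> + v))\<^sup>2"
  have s0: "s0 = 1 / (\<eta> ^ Suc l - 1)\<^sup>2"
  proof -
    have "\<eta> + v = (\<eta> ^ Suc l - 1) * (2 / \<eta> ^ l)" "\<eta> - v = 2 / \<eta> ^ l"
      using eta v by (simp_all add: field_simps)
    moreover have "2 / \<eta> ^ l \<noteq> 0" using eta by simp
    ultimately have "(\<eta> - v) / (\<eta> + v) = 1 / (\<eta> ^ Suc l - 1)" by (metis mult.commute mult.right_neutral nonzero_mult_divide_mult_cancel_left)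
    then show ?thesis by (simp add: s0_def power_divide)
  qed
  have v\<eta>: "v < \<eta>" using v eta by simp
  obtain p where p: "strict_mono p" "\<And>t. digit_embedding b p t \<in> uniform_set_ge b a v"
    "\<And>s::real. 0 < s \<Longrightarrow> s < s0 \<Longrightarrow> \<exists>C::real. \<forall>q. s * p q \<le> q + C"
    using uniform_embedding[OF v] unfolding s0 by blast
  have negl: "negligible {t \<in> {0..<1}. digit_embedding b p t \<in> E}"
    if s': "hausdorff_measure s' E = 0" "0 < s'" "s' < s0" for s' E
  proof -
    obtain C :: real where C: "\<And>q. s' * p q \<le> q + C" using p(3)[OF s'(2,3)] by blast
    show ?thesis
      by (rule holder_inverse_preimage_null[OF s'(2) _ embedding_inverse_holder[OF b p(1) s'(2) C] s'(1)])
         (use b in auto)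
  qed
  \<comment> \<open>A sequence tending to \<open>v\<close> from above; the shift by 2 keeps all its
    terms below \<open>\<eta>\<close>.\<close>
  define w where "w q = v + (\<eta> - v) / real (q + 2)" for q
  have w: "v < w q" "w q < \<eta>" for q
  proof -
    have "(\<eta> - v) / real (q + 2) < (\<eta> - v) / 1"
      using v\<eta> by (intro divide_strict_left_mono) auto
    then show "v < w q" "w q < \<eta>" using v\<eta> by (simp_all add: w_def)
  qed
  have "negligible {t \<in> {0..<1}. digit_embedding b p t \<in> uniform_set_ge b a (w q)}" for q
  proof -
    have "((\<eta> - w q) / (\<eta> + w q))\<^sup>2 < s0"
      unfolding s0_def using v(2) w by (rule dim_formula_strict_antimono)
    \<comment> \<open>Above the critical value of \<open>w q\<close> the set is null, and below
      \<open>s0\<close> the embedding has a Hoelder inverse; \<open>s'\<close> satisfies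
      both.\<close>
    then obtain s' where s': "((\<eta> - w q) / (\<eta> + w q))\<^sup>2 < s'" "s' < s0" using dense by blast
    have "0 < s'" using s'(1) by (smt (verit) zero_le_power2)
    then show ?thesis using negl[OF uniform_set_ge_null[OF _ w(2) s'(1)]] s'(2) v(2) w(1)[of q] by simp
  qed
  then have "negligible ({t \<in> {0..<1}. digit_embedding b p t \<in> uniform_set_eq b a v} \<union>
      (\<Union>q. {t \<in> {0..<1}. digit_embedding b p t \<in> uniform_set_ge b a (w q)}))"
    using negl[OF null s(1)] s(2) by (intro negligible_Un negligible_countable_Union) (auto simp: s0_def)
  moreover have "{0..<1} \<subseteq> {t \<in> {0..<1}. digit_embedding b p t \<in> uniform_set_eq b a v} \<union>
      (\<Union>q. {t \<in> {0..<1}. digit_embedding b p t \<in> uniform_set_ge b a (w q)})"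
  proof
    fix t :: real assume t: "t \<in> {0..<1}"
    let ?x = "uniform_exponent b a (digit_embedding b p t)"
    have "ereal v \<le> ?x" using p(2) by (simp add: uniform_set_ge_def)
    then consider "?x = ereal v" | "ereal v < ?x" by (auto simp: le_less)
    then show "t \<in> {t \<in> {0..<1}. digit_embedding b p t \<in> uniform_set_eq b a v} \<union>
      (\<Union>q. {t \<in> {0..<1}. digit_embedding b p t \<in> uniform_set_ge b a (w q)})"
    proof cases
      case 1
      with t show ?thesis by (simp add: uniform_set_eq_def)
    next
      case 2
      then obtain y where y: "ereal v < ereal y" "ereal y < ?x" using ereal_dense2 by blast
      have "w \<longlonglongrightarrow> v + 0"
        unfolding w_def by (intro tendsto_add tendsto_const LIMSEQ_ignore_initial_segment[of "\<lambda>q. (\<eta> - v) / real q"] lim_const_over_n)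
      then have "\<forall>\<^sub>F q in sequentially. w q < y" using y by (intro order_tendstoD) auto
      then obtain q where "w q < y" by (meson eventually_happens' sequentially_bot)
      then have "ereal (w q) < ?x" using y(2) by (meson less_ereal.simps(1) less_trans)
      then show ?thesis using t by (auto simp: uniform_set_ge_def intro: less_imp_le)
    qed
  qed
  ultimately have "negligible {0..<1::real}" by (rule negligible_subset)
  then have "negligible (cbox (0::real) (1/2))" by (rule negligible_subset) auto
  then show False using negligible_interval(1)[of "0::real" "1/2"] by simp
qed

end

theorem mainTheorem4:
  fixes b :: nat and a :: "nat \<Rightarrow> nat" and \<eta> v :: real and l :: nat
  assumes "b \<ge> 2"
    and "\<And>n. n \<ge> 1 \<Longrightarrow> a n > 0"
    and "strict_mono_on {1..} a"
    and "(\<lambda>n. real (a (n + 1)) / real (a n)) \<longlonglongrightarrow> \<eta>"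
    and "1 < \<eta>"
    and "v \<in> {0..\<eta>}"
    and "l \<ge> 1"
    and "v = \<eta> - 2 / \<eta> ^ l"
  shows "hausdorff_dim (uniform_set_eq b a v) = hausdorff_dim (uniform_set_ge b a v) \<and>
         hausdorff_dim (uniform_set_ge b a v) = ereal (((\<eta> - v) / (\<eta> + v))\<^sup>2)"
proof -
  interpret lacunary b a \<eta> using assms(1-5) by unfold_locales
  have v: "0 \<le> v" "v < \<eta>" using assms(5,6,8) by auto
  have "hausdorff_dim (uniform_set_ge b a v) \<le> ereal (((\<eta> - v) / (\<eta> + v))\<^sup>2)"
  proof (rule hausdorff_dim_le)
    fix s assume s: "((\<eta> - v) / (\<eta> + v))\<^sup>2 < s"
    show "hausdorff_measure s (uniform_set_ge b a v) = 0"
    \<comment> \<open>\<open>uniform_set_ge_null\<close> requires \<open>0 < v\<close>; for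
      \<open>v = 0\<close> the formula gives 1, and the trivial bound on the real line
      applies.\<close>
    proof (cases "v = 0")
      case True
      then show ?thesis using s assms(5) by (intro hausdorff_measure_real_zero) simp
    next
      case False
      then show ?thesis using v s by (intro uniform_set_ge_null) auto
    qed
  qed simp
  moreover have "ereal (((\<eta> - v) / (\<eta> + v))\<^sup>2) \<le> hausdorff_dim (uniform_set_eq b a v)"
    using v uniform_set_eq_not_null[OF assms(8) v(1)] by (intro hausdorff_dim_ge) auto
  moreover have "hausdorff_dim (uniform_set_eq b a v) \<le> hausdorff_dim (uniform_set_ge b a v)"
    by (rule hausdorff_dim_mono) (auto simp: uniform_set_eq_def uniform_set_ge_def)
  ultimately show ?thesis by (auto intro: antisym order_trans)
qed

end
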